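(* Let $D$ be a connected digraph with $n$ vertices and $m$ arcs, $\Gamma$ a finite group with $|\Gamma| = p$, $\alpha : A(D) \to \Gamma$ a pseudo ordinary voltage assignment, and $\mathbf{W}$ a weighted matrix of $D$. Let $\rho_1 = 1, \rho_2, \ldots, \rho_k$ be the (inequivalent, complex) irreducible representations of $\Gamma$, and let $d_i$ be the degree of $\rho_i$ for each $i$, where $d_1 = 1$. Suppose that the $\Gamma$-covering $D^\alpha$ of $D$ is connected. Then the determinant of the weighted matrix $\mathbf{W}(D^\alpha)$ of $D^\alpha$ derived from $\mathbf{W}$ is $$ \det(\mathbf{W}(D^\alpha)) = \prod_{j=1}^{k} \det\left( \sum_{h \in \Gamma} \rho_j(h) \otimes \mathbf{W}_h \right)^{d_j}. $$
   Context: $A(D)$ is the set of arcs of the digraph $D$, arcs being ordered pairs $(u,v)$ of vertices. A map $\alpha : A(D) \to \Gamma$ is a pseudo ordinary voltage assignment if $\alpha(v,u) = \alpha(u,v)^{-1}$ for each $(u,v) \in A(D)$ such that $(v,u) \in A(D)$. The derived digraph ($\Gamma$-covering) $D^\alpha$ has vertex set $V(D) \times \Gamma$, and $((u,h),(v,k)) \in A(D^\alpha)$ if and only if $(u,v) \in A(D)$ and $k = h\,\alpha(u,v)$; write $u_g = (u,g)$. A weighted matrix $\mathbf{W} = \mathbf{W}(D) = (w(u,v))_{u,v \in V(D)}$ of $D$ is an $n \times n$ matrix with $w(u,v)$ a nonzero complex number if $(u,v) \in A(D)$ and $w(u,v) = 0$ otherwise. The weighted matrix $\mathbf{W}(D^\alpha)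 = (\tilde{w}(u_g, v_h))$ derived from $\mathbf{W}$ is defined by $\tilde{w}(u_g, v_h) = w(u,v)$ if $(u,v) \in A(D)$ and $h = g\,\alpha(u,v)$, and $0$ otherwise. For $g \in \Gamma$, the $n \times n$ matrix $\mathbf{W}_g = (W^{(g)}_{uv})_{u,v \in V(D)}$ is given by $W^{(g)}_{uv} = w(u,v)$ if $(u,v) \in A(D)$ and $\alpha(u,v) = g$, and $0$ otherwise. $\otimes$ denotes the Kronecker product of matrices, and each $\rho_j(h)$ is viewed as a $d_j \times d_j$ matrix. *)

theory Defs
  imports
    Complex_Main
    "Graph_Theory.Pair_Digraph"
    "Graph_Theory.Digraph_Component"
    "Jordan_Normal_Form.Determinant"
    "Jordan_Normal_Form.VS_Connect"
begin

text \<open>Loops are allowed; on a loop the condition reads \<open>\<alpha> (v, v) = inv (\<alpha> (v, v))\<close>.\<close>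

definition pseudo_ordinary_voltage ::
    "'v pair_pre_digraph \<Rightarrow> ('g, 'b) monoid_scheme \<Rightarrow> ('v \<times> 'v \<Rightarrow> 'g) \<Rightarrow> bool" where
  "pseudo_ordinary_voltage D \<Gamma> \<alpha> \<longleftrightarrow>
     \<alpha> \<in> parcs D \<rightarrow> carrier \<Gamma> \<and>
     (\<forall>u v. (u, v) \<in> parcs D \<and> (v, u) \<in> parcs D \<longrightarrow> \<alpha> (v, u) = inv\<^bsub>\<Gamma>\<^esub> (\<alpha> (u, v)))"

definition derived_digraph ::
    "'v pair_pre_digraph \<Rightarrow> ('g, 'b) monoid_scheme \<Rightarrow> ('v \<times> 'v \<Rightarrow> 'g) \<Rightarrow>
     ('v \<times> 'g) pair_pre_digraph" where
  "derived_digraph D \<Gamma> \<alpha> =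
     \<lparr> pverts = pverts D \<times> carrier \<Gamma>,
       parcs = {((u, h), (v, k)) | u h v k.
         h \<in> carrier \<Gamma> \<and> k \<in> carrier \<Gamma> \<and> (u, v) \<in> parcs D \<and> k = h \<otimes>\<^bsub>\<Gamma>\<^esub> \<alpha> (u, v)} \<rparr>"

definition weighted_matrix :: "'v pair_pre_digraph \<Rightarrow> ('v \<Rightarrow> 'v \<Rightarrow> complex) \<Rightarrow> bool" where
  "weighted_matrix D w \<longleftrightarrow>
     (\<forall>u \<in> pverts D. \<forall>v \<in> pverts D. w u v \<noteq> 0 \<longleftrightarrow> (u, v) \<in> parcs D)"

definition derived_weight ::
    "'v pair_pre_digraph \<Rightarrow> ('g, 'b) monoid_scheme \<Rightarrow> ('v \<times> 'v \<Rightarrow> 'g) \<Rightarrow> ('v \<Rightarrow> 'v \<Rightarrow> complex) \<Rightarrow>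
     'v \<times> 'g \<Rightarrow> 'v \<times> 'g \<Rightarrow> complex" where
  "derived_weight D \<Gamma> \<alpha> w = (\<lambda>(u, g) (v, h).
     if (u, v) \<in> parcs D \<and> h = g \<otimes>\<^bsub>\<Gamma>\<^esub> \<alpha> (u, v) then w u v else 0)"

definition voltage_weight ::
    "'v pair_pre_digraph \<Rightarrow> ('v \<times> 'v \<Rightarrow> 'g) \<Rightarrow> ('v \<Rightarrow> 'v \<Rightarrow> complex) \<Rightarrow> 'g \<Rightarrow>
     'v \<Rightarrow> 'v \<Rightarrow> complex" where
  "voltage_weight D \<alpha> w g u v = (if (u, v) \<in> parcs D \<and> \<alpha> (u, v) = g then w u v else 0)"

text \<open>An ordering of a finite index set is a distinct list of its elements; rows and columns
  of a matrix indexed by that set are numbered by the same ordering.\<close>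

definition ordering_of :: "'a list \<Rightarrow> 'a set \<Rightarrow> bool" where
  "ordering_of xs S \<longleftrightarrow> distinct xs \<and> set xs = S"

definition matrix_of :: "'a list \<Rightarrow> ('a \<Rightarrow> 'a \<Rightarrow> complex) \<Rightarrow> complex mat" where
  "matrix_of xs f = mat (length xs) (length xs) (\<lambda>(i, j). f (xs ! i) (xs ! j))"

definition kronecker :: "complex mat \<Rightarrow> complex mat \<Rightarrow> complex mat" where
  "kronecker A B = mat (dim_row A * dim_row B) (dim_col A * dim_col B)
     (\<lambda>(i, j). A $$ (i div dim_row B, j div dim_col B) * B $$ (i mod dim_row B, j mod dim_col B))"

text \<open>The group of units of the ring of complex \<open>d \<times> d\<close> matrices is \<open>GL\<^sub>d(\<complex>)\<close>.\<close>

definition representation ::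
    "('g, 'b) monoid_scheme \<Rightarrow> nat \<Rightarrow> ('g \<Rightarrow> complex mat) \<Rightarrow> bool" where
  "representation \<Gamma> d \<rho> \<longleftrightarrow> \<rho> \<in> hom \<Gamma> (units_of (ring_mat TYPE(complex) d ()))"

definition irreducible_representation ::
    "('g, 'b) monoid_scheme \<Rightarrow> nat \<Rightarrow> ('g \<Rightarrow> complex mat) \<Rightarrow> bool" where
  "irreducible_representation \<Gamma> d \<rho> \<longleftrightarrow>
     representation \<Gamma> d \<rho> \<and> d > 0 \<and>
     (\<forall>U. VectorSpace.subspace class_ring U (module_vec TYPE(complex) d) \<and>
          (\<forall>g \<in> carrier \<Gamma>. \<forall>x \<in> U. \<rho> g *\<^sub>v x \<in> U) \<longrightarrow>
          U = {0\<^sub>v d} \<or> U = carrier_vec d)"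

definition equivalent_representations ::
    "('g, 'b) monoid_scheme \<Rightarrow> nat \<Rightarrow> ('g \<Rightarrow> complex mat) \<Rightarrow> nat \<Rightarrow> ('g \<Rightarrow> complex mat) \<Rightarrow> bool" where
  "equivalent_representations \<Gamma> d \<rho> e \<sigma> \<longleftrightarrow>
     d = e \<and> (\<exists>P \<in> Units (ring_mat TYPE(complex) d ()). \<forall>g \<in> carrier \<Gamma>. \<sigma> g * P = P * \<rho> g)"

definition complete_irreducibles ::
    "('g, 'b) monoid_scheme \<Rightarrow> nat \<Rightarrow> (nat \<Rightarrow> nat) \<Rightarrow> (nat \<Rightarrow> 'g \<Rightarrow> complex mat) \<Rightarrow> bool" where
  "complete_irreducibles \<Gamma> k d \<rho> \<longleftrightarrow>
     (\<forall>i \<in> {1..k}. irreducible_representation \<Gamma> (d i) (\<rho> i)) \<and>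
     (\<forall>i \<in> {1..k}. \<forall>j \<in> {1..k}. i \<noteq> j \<longrightarrow>
        \<not> equivalent_representations \<Gamma> (d i) (\<rho> i) (d j) (\<rho> j)) \<and>
     (\<forall>e \<sigma>. irreducible_representation \<Gamma> e \<sigma> \<longrightarrow>
        (\<exists>i \<in> {1..k}. equivalent_representations \<Gamma> e \<sigma> (d i) (\<rho> i)))"

end

theory Submission
  imports Defs "Jordan_Normal_Form.Spectral_Radius"
begin

text \<open>Numbering the fibre over a vertex by \<open>\<Gamma>\<close> turns the weighted matrix of the covering into
  \<open>\<Sum>\<^sub>h R(h) \<otimes> W\<^sub>h\<close>, where \<open>R(h)\<close> has entry \<open>1\<close> at \<open>(g, g h)\<close> and \<open>0\<close> elsewhere: \<open>R\<close> is the right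
  regular representation. Since \<open>R\<close> contains every irreducible representation \<open>\<rho>\<^sub>j\<close> exactly \<open>d\<^sub>j\<close> times,
  a base change on the group factor splits the sum into \<open>d\<^sub>j\<close> copies of \<open>\<Sum>\<^sub>h \<rho>\<^sub>j(h) \<otimes> W\<^sub>h\<close> for each
  \<open>j\<close>, and the determinant becomes the stated product.

  The base change is explicit. Its matrix \<open>Q\<close> has as columns the matrix coefficients
  \<open>g \<mapsto> \<rho>\<^sub>j(g)\<^sub>a\<^sub>b\<close>, indexed by the triples \<open>(j, a, b)\<close>. The identity
  \<open>\<rho>\<^sub>j(g h)\<^sub>a\<^sub>b = \<Sum>\<^sub>c \<rho>\<^sub>j(g)\<^sub>a\<^sub>c \<rho>\<^sub>j(h)\<^sub>c\<^sub>b\<close> says that \<open>R(h) Q = Q M\<close>, where \<open>M\<close> is block diagonal with one block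
  \<open>\<rho>\<^sub>j(h)\<close> for each pair \<open>(j, a)\<close>. The inverse of \<open>Q\<close> is the matrix \<open>S\<close> with entries
  \<open>(d\<^sub>j / |\<Gamma>|) \<rho>\<^sub>j(g\<inverse>)\<^sub>b\<^sub>a\<close>:
  \<^item> \<open>S Q = 1\<close> is Schur orthogonality (\<open>irreducible_coefficients_orthogonal\<close>), which follows from
    Schur's lemma applied to averaged intertwiners.
  \<^item> \<open>Q S = 1\<close> is the completeness of the coefficients (\<open>irreducible_coefficients_complete\<close>). It
    rests on \<open>irreducible_coefficients_separate\<close>: only the zero function is annihilated by all
    irreducible representations. Otherwise the functions whose conjugate is annihilated form a
    nonzero translation-invariant space. A nonzero invariant subspace of minimal dimension carries
    an irreducible representation, so its elements are combinations of the coefficients of some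
    \<open>\<rho>\<^sub>i\<close>, to which they are also orthogonal. They vanish, a contradiction.

  This yields the multiplicities \<open>d\<^sub>j\<close> and \<open>\<Sum>\<^sub>j d\<^sub>j\<^sup>2 = |\<Gamma>|\<close> at once, without decomposing an arbitrary
  representation into irreducible ones.\<close>

section \<open>Injective matrices and subspaces\<close>

lemma index_mult_mat_sum:
  assumes "A \<in> carrier_mat m n" "B \<in> carrier_mat n k" "i < m" "j < k"
  shows "(A * B) $$ (i, j) = (\<Sum>l<n. A $$ (i, l) * B $$ (l, j))"
  using assms by (simp add: scalar_prod_def atLeast0LessThan)

lemma index_mult_mat_vec_sum:
  assumes "A \<in> carrier_mat m n" "v \<in> carrier_vec n" "i < m"
  shows "(A *\<^sub>v v) $ i = (\<Sum>l<n. A $$ (i, l) * v $ l)"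
  using assms by (simp add: scalar_prod_def atLeast0LessThan)

definition injective_matrix :: "'a::field mat \<Rightarrow> bool" where
  "injective_matrix A \<longleftrightarrow>
     (\<forall>v \<in> carrier_vec (dim_col A). A *\<^sub>v v = 0\<^sub>v (dim_row A) \<longrightarrow> v = 0\<^sub>v (dim_col A))"

lemma injective_matrixD:
  assumes "injective_matrix A" "A \<in> carrier_mat m n" "v \<in> carrier_vec n" "A *\<^sub>v v = 0\<^sub>v m"
  shows "v = 0\<^sub>v n"
  using assms unfolding injective_matrix_def by auto

lemma injective_matrixI:
  assumes "A \<in> carrier_mat m n"
    and "\<And>v. v \<in> carrier_vec n \<Longrightarrow> A *\<^sub>v v = 0\<^sub>v m \<Longrightarrow> v = 0\<^sub>v n"
  shows "injective_matrix A"
  using assms unfolding injective_matrix_def by auto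

lemma left_inverse_imp_injective:
  assumes A: "A \<in> carrier_mat m n" and B: "B \<in> carrier_mat n m" and "B * A = 1\<^sub>m n"
  shows "injective_matrix A"
proof (rule injective_matrixI[OF A])
  fix v assume v: "v \<in> carrier_vec n" and "A *\<^sub>v v = 0\<^sub>v m"
  then have "B *\<^sub>v (A *\<^sub>v v) = 0\<^sub>v n" using B by auto
  then show "v = 0\<^sub>v n" using assms v by (simp flip: assoc_mult_mat_vec[OF B A v])
qed

text \<open>Padding a matrix with more columns than rows by zero rows makes it square and singular, which
  exhibits a nonzero vector in the kernel.\<close>

lemma injective_imp_dim_le:
  assumes A: "A \<in> carrier_mat m n" and "injective_matrix A"
  shows "n \<le> m"
proof (rule ccontr)
  assume "\<not> n \<le> m"
  then have mn: "m < n" by simp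
  define B where "B = mat n n (\<lambda>(i, j). if i < m then A $$ (i, j) else 0)"
  have B: "B \<in> carrier_mat n n" by (simp add: B_def)
  have "transpose_mat B *\<^sub>v unit_vec n m = 0\<^sub>v n"
    by (rule eq_vecI) (use mn B in \<open>auto simp: B_def\<close>)
  then have "det (transpose_mat B) = 0"
    using mn B by (subst det_0_iff_vec_prod_zero_field[of _ n])
      (auto intro!: exI[of _ "unit_vec n m"])
  then have "det B = 0" using det_transpose[OF B] by simp
  then obtain v where v: "v \<in> carrier_vec n" "v \<noteq> 0\<^sub>v n" "B *\<^sub>v v = 0\<^sub>v n"
    using det_0_iff_vec_prod_zero_field[OF B] by auto
  have "A *\<^sub>v v = 0\<^sub>v m"
  proof (rule eq_vecI)
    fix i assume "i < dim_vec (0\<^sub>v m)"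
    then have i: "i < m" by simp
    have "(A *\<^sub>v v) $ i = (B *\<^sub>v v) $ i"
      using i mn by (simp add: index_mult_mat_vec_sum[OF A v(1)] index_mult_mat_vec_sum[OF B v(1)])
        (simp add: B_def)
    then show "(A *\<^sub>v v) $ i = 0\<^sub>v m $ i" using v i mn by simp
  qed (use A in simp)
  with injective_matrixD[OF assms(2) A v(1)] v(2) show False by simp
qed

lemma injective_mult_cancel:
  assumes "injective_matrix A" and A: "A \<in> carrier_mat m n"
    and X: "X \<in> carrier_mat n k" and Y: "Y \<in> carrier_mat n k" and eq: "A * X = A * Y"
  shows "X = Y"
proof (rule eq_matI)
  fix i j assume "i < dim_row Y" "j < dim_col Y"
  then have ij: "i < n" "j < k" using Y by auto
  have "A *\<^sub>v (col X j - col Y j) = A *\<^sub>v col X j - A *\<^sub>v col Y j"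
    using A X Y by (intro mult_minus_distrib_mat_vec) auto
  also have "A *\<^sub>v col X j = A *\<^sub>v col Y j"
    using arg_cong[OF eq, of "\<lambda>M. col M j"] ij col_mult2[OF A X] col_mult2[OF A Y] by simp
  finally have "A *\<^sub>v (col X j - col Y j) = 0\<^sub>v m" using A by auto
  then have "col X j - col Y j = 0\<^sub>v n"
    using X Y by (intro injective_matrixD[OF assms(1) A] carrier_vecI) auto
  from arg_cong[OF this, of "\<lambda>v. v $ i"] show "X $$ (i, j) = Y $$ (i, j)"
    using ij X Y by auto
qed (use X Y in auto)

lemma square_injective_imp_inverse:
  assumes "injective_matrix A" and A: "A \<in> carrier_mat n n"
  obtains B where "B \<in> carrier_mat n n" "A * B = 1\<^sub>m n" "B * A = 1\<^sub>m n"
proof -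
  have "det A \<noteq> 0"
    using assms(1) unfolding det_0_iff_vec_prod_zero_field[OF A] by (auto dest: injective_matrixD[OF _ A])
  from det_non_zero_imp_unit[OF A this, of "()"] that show thesis
    unfolding Units_def by (auto simp: ring_mat_simps)
qed

lemma surjective_imp_right_inverse:
  fixes A :: "'a::field mat"
  assumes A: "A \<in> carrier_mat m n"
    and surj: "\<And>y. y \<in> carrier_vec m \<Longrightarrow> \<exists>x \<in> carrier_vec n. A *\<^sub>v x = y"
  obtains B where "B \<in> carrier_mat n m" "A * B = 1\<^sub>m m"
proof -
  have "\<forall>j. \<exists>x. j < m \<longrightarrow> x \<in> carrier_vec n \<and> A *\<^sub>v x = unit_vec m j"
    using surj[OF unit_vec_carrier] by blast
  then obtain f where f: "\<And>j. j < m \<Longrightarrow> f j \<in> carrier_vec n \<and> A *\<^sub>v f j = unit_vec m j"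
    by metis
  define B where "B = mat n m (\<lambda>(i, j). f j $ i)"
  have B: "B \<in> carrier_mat n m" by (simp add: B_def)
  have "A * B = 1\<^sub>m m"
  proof (rule eq_matI)
    fix i j assume "i < dim_row (1\<^sub>m m)" "j < dim_col (1\<^sub>m m :: 'a mat)"
    then have ij: "i < m" "j < m" by auto
    have "col B j = f j" using f[OF ij(2)] ij by (intro eq_vecI) (auto simp: B_def)
    then have "(A * B) $$ (i, j) = (A *\<^sub>v f j) $ i" using A B ij by auto
    then show "(A * B) $$ (i, j) = 1\<^sub>m m $$ (i, j)" using f[OF ij(2)] ij by simp
  qed (use A B in auto)
  with B that show thesis by blast
qed

text \<open>\<open>Q\<close> and \<open>S\<close> are not assumed square: being mutually inverse forces \<open>m = n\<close>. In the
  application \<open>m\<close> is \<open>|\<Gamma>|\<close> times the number of vertices and \<open>n\<close> is \<open>\<Sum>\<^sub>j d\<^sub>j\<^sup>2\<close> times that number, so this is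
  where \<open>|\<Gamma>| = \<Sum>\<^sub>j d\<^sub>j\<^sup>2\<close> comes from.\<close>

lemma det_eq_of_intertwining:
  assumes A: "A \<in> carrier_mat m m" and B: "B \<in> carrier_mat n n"
    and Q: "Q \<in> carrier_mat m n" and S: "S \<in> carrier_mat n m"
    and QS: "Q * S = 1\<^sub>m m" and SQ: "S * Q = 1\<^sub>m n" and AQ: "A * Q = Q * B"
  shows "det A = det (B :: 'a::field mat)"
proof -
  have "n \<le> m" using injective_imp_dim_le[OF Q left_inverse_imp_injective[OF Q S SQ]] .
  moreover have "m \<le> n" using injective_imp_dim_le[OF S left_inverse_imp_injective[OF S Q QS]] .
  ultimately have [simp]: "m = n" by simp
  have "det Q * det S = 1"
    using det_mult[of Q n S] Q S QS by simp
  then have "det Q \<noteq> 0" by auto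
  moreover have "det A * det Q = det Q * det B"
    using arg_cong[OF AQ, of det] det_mult[of A n Q] det_mult[of Q n B] A B Q by auto
  ultimately show ?thesis by simp
qed

text \<open>The columns of \<open>B\<close> are a basis of \<open>U\<close>. An injective matrix with columns in \<open>U\<close> and the
  largest possible number of columns must span \<open>U\<close>: a vector outside its range could be appended
  as one more column.\<close>

lemma subspace_basis_matrix:
  fixes U :: "'a::field vec set"
  assumes U: "U \<subseteq> carrier_vec m" "0\<^sub>v m \<in> U"
    and add: "\<And>x y. x \<in> U \<Longrightarrow> y \<in> U \<Longrightarrow> x + y \<in> U"
    and smult: "\<And>c x. x \<in> U \<Longrightarrow> c \<cdot>\<^sub>v x \<in> U"
  obtains r B where "B \<in> carrier_mat m r" "injective_matrix B"
    "U = (\<lambda>v. B *\<^sub>v v) ` carrier_vec r"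
proof -
  define P where "P = (\<lambda>r. \<exists>B \<in> carrier_mat m r. injective_matrix B \<and>
    (\<forall>v \<in> carrier_vec r. B *\<^sub>v v \<in> U))"
  have "P 0"
  proof -
    let ?B = "0\<^sub>m m 0 :: 'a mat"
    have "injective_matrix ?B" by (auto simp: injective_matrix_def)
    moreover have "?B *\<^sub>v v \<in> U" if "v \<in> carrier_vec 0" for v
    proof -
      have "?B *\<^sub>v v = 0\<^sub>v m"
        using that by (intro eq_vecI) (auto simp: scalar_prod_def)
      then show ?thesis using U by simp
    qed
    ultimately show ?thesis unfolding P_def by (intro bexI[of _ ?B]) auto
  qed
  moreover have "\<forall>r. P r \<longrightarrow> r \<le> m"
    unfolding P_def using injective_imp_dim_le by blast
  ultimately obtain r where "P r" and max: "\<And>s. P s \<Longrightarrow> s \<le> r"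
    using GreatestI_nat[of P 0 m] Greatest_le_nat[of P _ m] by blast
  then obtain B where B: "B \<in> carrier_mat m r" and inj: "injective_matrix B"
    and BU: "\<And>v. v \<in> carrier_vec r \<Longrightarrow> B *\<^sub>v v \<in> U" unfolding P_def by blast
  have "u \<in> (\<lambda>v. B *\<^sub>v v) ` carrier_vec r" if u: "u \<in> U" for u
  proof (rule ccontr)
    assume nu: "u \<notin> (\<lambda>v. B *\<^sub>v v) ` carrier_vec r"
    have uc: "u \<in> carrier_vec m" using u U by auto
    define C where "C = mat m (Suc r) (\<lambda>(i, j). if j < r then B $$ (i, j) else u $ i)"
    have C: "C \<in> carrier_mat m (Suc r)" by (simp add: C_def)
    have Cv: "C *\<^sub>v v = B *\<^sub>v vec r (\<lambda>i. v $ i) + v $ r \<cdot>\<^sub>v u" if v: "v \<in> carrier_vec (Suc r)" for v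
    proof (rule eq_vecI)
      fix i assume "i < dim_vec (B *\<^sub>v vec r (\<lambda>i. v $ i) + v $ r \<cdot>\<^sub>v u)"
      then have i: "i < m" using uc by auto
      show "(C *\<^sub>v v) $ i = (B *\<^sub>v vec r (\<lambda>i. v $ i) + v $ r \<cdot>\<^sub>v u) $ i"
      proof -
        have "(C *\<^sub>v v) $ i = (\<Sum>l<r. B $$ (i, l) * v $ l) + v $ r * u $ i"
          unfolding index_mult_mat_vec_sum[OF C v i] using i by (simp add: C_def)
        then show ?thesis
          using i uc B index_mult_mat_vec_sum[OF B vec_carrier i, of "\<lambda>i. v $ i"]
          by (simp del: index_mult_mat_vec)
      qed
    qed (use C uc in auto)
    have "injective_matrix C"
    proof (rule injective_matrixI[OF C])
      fix v assume v: "v \<in> carrier_vec (Suc r)" and 0: "C *\<^sub>v v = 0\<^sub>v m"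
      let ?v = "vec r (\<lambda>i. v $ i)"
      have vr: "v $ r = 0"
      proof (rule ccontr)
        assume nz: "v $ r \<noteq> 0"
        have "u = B *\<^sub>v ((- inverse (v $ r)) \<cdot>\<^sub>v ?v)"
        proof (rule eq_vecI)
          fix i assume "i < dim_vec (B *\<^sub>v ((- inverse (v $ r)) \<cdot>\<^sub>v ?v))"
          then have i: "i < m" using B by auto
          have "(B *\<^sub>v ?v) $ i + v $ r * u $ i = 0"
            using arg_cong[OF 0[unfolded Cv[OF v]], of "\<lambda>w. w $ i"] i uc B by simp
          then have "u $ i = - inverse (v $ r) * (B *\<^sub>v ?v) $ i"
            using nz by (simp add: field_simps eq_neg_iff_add_eq_0)
          then show "u $ i = (B *\<^sub>v ((- inverse (v $ r)) \<cdot>\<^sub>v ?v)) $ i"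
            using B i by (subst mult_mat_vec[OF B]) auto
        qed (use uc B in auto)
        then show False using nu by auto
      qed
      have "B *\<^sub>v ?v = 0\<^sub>v m"
      proof (rule eq_vecI)
        fix i assume "i < dim_vec (0\<^sub>v m)"
        then have i: "i < m" by simp
        show "(B *\<^sub>v ?v) $ i = 0\<^sub>v m $ i"
          using arg_cong[OF 0[unfolded Cv[OF v]], of "\<lambda>w. w $ i"] i uc B vr by simp
      qed (use B in auto)
      then have z: "?v = 0\<^sub>v r" by (intro injective_matrixD[OF inj B]) auto
      show "v = 0\<^sub>v (Suc r)"
      proof (rule eq_vecI)
        fix i assume "i < dim_vec (0\<^sub>v (Suc r))"
        then have "i < r \<or> i = r" by auto
        then show "v $ i = 0\<^sub>v (Suc r) $ i"
          using arg_cong[OF z, of "\<lambda>w. w $ i"] vr by auto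
      qed (use v in auto)
    qed
    moreover have "C *\<^sub>v v \<in> U" if "v \<in> carrier_vec (Suc r)" for v
      unfolding Cv[OF that] by (intro add smult BU u) auto
    ultimately have "P (Suc r)" unfolding P_def using C by auto
    then show False using max[of "Suc r"] by simp
  qed
  then have "U = (\<lambda>v. B *\<^sub>v v) ` carrier_vec r" using BU by blast
  with B inj that show thesis by blast
qed

lemma range_of_square_injective:
  assumes "injective_matrix A" and A: "A \<in> carrier_mat n n"
  shows "(\<lambda>v. A *\<^sub>v v) ` carrier_vec n = carrier_vec n"
proof -
  obtain B where B: "B \<in> carrier_mat n n" "A * B = 1\<^sub>m n"
    using square_injective_imp_inverse[OF assms] by metis
  have "v \<in> (\<lambda>v. A *\<^sub>v v) ` carrier_vec n" if v: "v \<in> carrier_vec n" for v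
  proof
    show "v = A *\<^sub>v (B *\<^sub>v v)" using B v by (simp flip: assoc_mult_mat_vec[OF A B(1) v])
    show "B *\<^sub>v v \<in> carrier_vec n" using B v by auto
  qed
  then show ?thesis using A by auto
qed

text \<open>For injective \<open>F\<close> with range \<open>U\<close> and \<open>A = R F\<close>, the factor \<open>S\<close> is the matrix, in the basis \<open>F\<close>, of
  the restriction of \<open>R\<close> to an invariant subspace \<open>U\<close>.\<close>

lemma columnwise_factorization:
  fixes A :: "'a::field mat"
  assumes A: "A \<in> carrier_mat m n" and F: "F \<in> carrier_mat m r"
    and ex: "\<And>v. v \<in> carrier_vec n \<Longrightarrow> \<exists>w \<in> carrier_vec r. A *\<^sub>v v = F *\<^sub>v w"
  shows "\<exists>S \<in> carrier_mat r n. A = F * S"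
proof -
  have "\<forall>j. \<exists>w. j < n \<longrightarrow> w \<in> carrier_vec r \<and> A *\<^sub>v unit_vec n j = F *\<^sub>v w"
    using ex[OF unit_vec_carrier] by blast
  then obtain w where w: "\<And>j. j < n \<Longrightarrow> w j \<in> carrier_vec r \<and> A *\<^sub>v unit_vec n j = F *\<^sub>v w j"
    by metis
  define S where "S = mat r n (\<lambda>(i, j). w j $ i)"
  have S: "S \<in> carrier_mat r n" by (simp add: S_def)
  have "A = F * S"
  proof (rule eq_matI)
    fix i j assume "i < dim_row (F * S)" "j < dim_col (F * S)"
    then have ij: "i < m" "j < n" using F S by auto
    have "col S j = w j" using w[OF ij(2)] ij by (intro eq_vecI) (auto simp: S_def)
    then have "(F * S) $$ (i, j) = (F *\<^sub>v w j) $ i" using F S ij by auto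
    also have "\<dots> = (A *\<^sub>v unit_vec n j) $ i" using w[OF ij(2)] by simp
    also have "\<dots> = A $$ (i, j)" using A ij by simp
    finally show "A $$ (i, j) = (F * S) $$ (i, j)" by simp
  qed (use A F S in auto)
  with S show ?thesis by blast
qed

lemma mat_eq_zeroI:
  assumes A: "A \<in> carrier_mat m n" and "\<And>v. v \<in> carrier_vec n \<Longrightarrow> A *\<^sub>v v = 0\<^sub>v m"
  shows "A = (0\<^sub>m m n :: 'a::comm_ring_1 mat)"
proof (rule eq_matI)
  fix i j assume ij: "i < dim_row (0\<^sub>m m n :: 'a mat)" "j < dim_col (0\<^sub>m m n :: 'a mat)"
  then show "A $$ (i, j) = 0\<^sub>m m n $$ (i, j)"
    using arg_cong[OF assms(2)[of "unit_vec n j"], of "\<lambda>v. v $ i"] A by auto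
qed (use A in auto)

section \<open>Schur's lemma and orthogonality\<close>

lemma representationD:
  assumes \<Gamma>: "group \<Gamma>" and rep: "representation \<Gamma> d \<rho>"
  shows representation_carrier: "g \<in> carrier \<Gamma> \<Longrightarrow> \<rho> g \<in> carrier_mat d d"
    and representation_mult:
      "g \<in> carrier \<Gamma> \<Longrightarrow> h \<in> carrier \<Gamma> \<Longrightarrow> \<rho> (g \<otimes>\<^bsub>\<Gamma>\<^esub> h) = \<rho> g * \<rho> h"
    and representation_one: "\<rho> \<one>\<^bsub>\<Gamma>\<^esub> = 1\<^sub>m d"
proof -
  interpret R: ring "ring_mat TYPE(complex) d ()" by (rule ring_mat)
  interpret hom: group_hom \<Gamma> "units_of (ring_mat TYPE(complex) d ())" \<rho>
    using \<Gamma> rep R.units_group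
    by (simp add: group_hom_def group_hom_axioms_def representation_def)
  show "g \<in> carrier \<Gamma> \<Longrightarrow> \<rho> g \<in> carrier_mat d d"
    using hom.hom_closed[of g] by (simp add: units_of_carrier Units_def ring_mat_simps)
  show "g \<in> carrier \<Gamma> \<Longrightarrow> h \<in> carrier \<Gamma> \<Longrightarrow> \<rho> (g \<otimes>\<^bsub>\<Gamma>\<^esub> h) = \<rho> g * \<rho> h"
    using hom.hom_mult[of g h] by (simp add: units_of_mult ring_mat_simps)
  show "\<rho> \<one>\<^bsub>\<Gamma>\<^esub> = 1\<^sub>m d"
    using hom.hom_one by (simp add: units_of_one ring_mat_simps)
qed

lemma representationI:
  assumes \<Gamma>: "group \<Gamma>"
    and car: "\<And>g. g \<in> carrier \<Gamma> \<Longrightarrow> \<rho> g \<in> carrier_mat d d"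
    and mult: "\<And>g h. g \<in> carrier \<Gamma> \<Longrightarrow> h \<in> carrier \<Gamma> \<Longrightarrow> \<rho> (g \<otimes>\<^bsub>\<Gamma>\<^esub> h) = \<rho> g * \<rho> h"
    and one: "\<rho> \<one>\<^bsub>\<Gamma>\<^esub> = 1\<^sub>m d"
  shows "representation \<Gamma> d \<rho>"
proof -
  interpret group \<Gamma> by fact
  have "\<rho> g \<in> Units (ring_mat TYPE(complex) d ())" if g: "g \<in> carrier \<Gamma>" for g
    unfolding Units_def ring_mat_simps
    using g car[of g] car[of "inv\<^bsub>\<Gamma>\<^esub> g"] mult[of g "inv\<^bsub>\<Gamma>\<^esub> g"] mult[of "inv\<^bsub>\<Gamma>\<^esub> g" g] one
    by (auto intro!: bexI[of _ "\<rho> (inv\<^bsub>\<Gamma>\<^esub> g)"])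
  then show ?thesis
    unfolding representation_def hom_def
    by (auto simp: units_of_carrier units_of_mult ring_mat_simps mult)
qed

lemma subspace_module_vec_iff:
  "VectorSpace.subspace class_ring U (module_vec TYPE(complex) n) \<longleftrightarrow>
     U \<subseteq> carrier_vec n \<and> 0\<^sub>v n \<in> U \<and> (\<forall>x \<in> U. \<forall>y \<in> U. x + y \<in> U) \<and> (\<forall>c. \<forall>x \<in> U. c \<cdot>\<^sub>v x \<in> U)"
  using vec_vs[of n, where 'a = complex] vec_module[of n, where 'a = complex]
  unfolding VectorSpace.subspace_def submodule_def module_vec_simps class_ring_simps
  by (simp only: simp_thms UNIV_I imp_conjL Ball_def) fast

lemma irreducible_invariant_subspace:
  assumes "irreducible_representation \<Gamma> d \<rho>"
    and "U \<subseteq> carrier_vec d" "0\<^sub>v d \<in> U"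
    and "\<And>x y. x \<in> U \<Longrightarrow> y \<in> U \<Longrightarrow> x + y \<in> U"
    and "\<And>c x. x \<in> U \<Longrightarrow> c \<cdot>\<^sub>v x \<in> U"
    and "\<And>g x. g \<in> carrier \<Gamma> \<Longrightarrow> x \<in> U \<Longrightarrow> \<rho> g *\<^sub>v x \<in> U"
  shows "U = {0\<^sub>v d} \<or> U = carrier_vec d"
proof -
  have "VectorSpace.subspace class_ring U (module_vec TYPE(complex) d)"
    unfolding subspace_module_vec_iff using assms(2-5) by simp
  moreover have "\<forall>g \<in> carrier \<Gamma>. \<forall>x \<in> U. \<rho> g *\<^sub>v x \<in> U" using assms(6) by simp
  ultimately show ?thesis using assms(1) unfolding irreducible_representation_def by simp
qed

text \<open>The kernel and the range of an intertwiner are invariant subspaces. If it is nonzero, the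
  kernel is therefore zero and the range everything, and comparing dimensions gives \<open>m = n\<close>.\<close>

lemma schur_intertwiner:
  assumes \<Gamma>: "group \<Gamma>"
    and \<rho>: "irreducible_representation \<Gamma> n \<rho>" and \<sigma>: "irreducible_representation \<Gamma> m \<sigma>"
    and T: "T \<in> carrier_mat m n"
    and comm: "\<And>g. g \<in> carrier \<Gamma> \<Longrightarrow> T * \<rho> g = \<sigma> g * T"
    and nz: "T \<noteq> 0\<^sub>m m n"
  shows "m = n \<and> injective_matrix T"
proof -
  have \<rho>c: "\<And>g. g \<in> carrier \<Gamma> \<Longrightarrow> \<rho> g \<in> carrier_mat n n"
    and \<sigma>c: "\<And>g. g \<in> carrier \<Gamma> \<Longrightarrow> \<sigma> g \<in> carrier_mat m m"
    using \<rho> \<sigma> \<Gamma> by (auto simp: irreducible_representation_def representation_carrier)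
  have comm_vec: "T *\<^sub>v (\<rho> g *\<^sub>v x) = \<sigma> g *\<^sub>v (T *\<^sub>v x)"
    if "g \<in> carrier \<Gamma>" "x \<in> carrier_vec n" for g x
    using comm[OF that(1)] assoc_mult_mat_vec[OF T \<rho>c[OF that(1)] that(2)]
      assoc_mult_mat_vec[OF \<sigma>c[OF that(1)] T that(2)] by simp
  define K where "K = {v \<in> carrier_vec n. T *\<^sub>v v = 0\<^sub>v m}"
  have "K = {0\<^sub>v n} \<or> K = carrier_vec n"
  proof (rule irreducible_invariant_subspace[OF \<rho>])
    show "0\<^sub>v n \<in> K" using T by (auto simp: K_def)
    show "x + y \<in> K" if "x \<in> K" "y \<in> K" for x y
      using that T by (auto simp: K_def mult_add_distrib_mat_vec)
    show "c \<cdot>\<^sub>v x \<in> K" if "x \<in> K" for c x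
      using that T by (auto simp: K_def mult_mat_vec)
    show "\<rho> g *\<^sub>v x \<in> K" if "g \<in> carrier \<Gamma>" "x \<in> K" for g x
      using that T \<rho>c[OF that(1)] comm_vec[OF that(1)] \<sigma>c[OF that(1)]
      by (auto simp: K_def)
  qed (auto simp: K_def)
  moreover have "K \<noteq> carrier_vec n"
    using mat_eq_zeroI[OF T] nz by (auto simp: K_def)
  ultimately have inj: "injective_matrix T"
    by (intro injective_matrixI[OF T]) (auto simp: K_def)
  define I where "I = (\<lambda>v. T *\<^sub>v v) ` carrier_vec n"
  have "I = {0\<^sub>v m} \<or> I = carrier_vec m"
  proof (rule irreducible_invariant_subspace[OF \<sigma>])
    have "T *\<^sub>v 0\<^sub>v n = 0\<^sub>v m" using T by auto
    then show "0\<^sub>v m \<in> I" unfolding I_def by (metis image_eqI zero_carrier_vec)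
    show "x + y \<in> I" if xy: "x \<in> I" "y \<in> I" for x y
    proof -
      obtain a b where "a \<in> carrier_vec n" "b \<in> carrier_vec n" "x = T *\<^sub>v a" "y = T *\<^sub>v b"
        using xy by (auto simp: I_def)
      then show ?thesis
        unfolding I_def by (intro image_eqI[of _ _ "a + b"]) (auto simp: mult_add_distrib_mat_vec[OF T])
    qed
    show "c \<cdot>\<^sub>v x \<in> I" if x: "x \<in> I" for c x
    proof -
      obtain a where "a \<in> carrier_vec n" "x = T *\<^sub>v a" using x by (auto simp: I_def)
      then show ?thesis
        unfolding I_def by (intro image_eqI[of _ _ "c \<cdot>\<^sub>v a"]) (auto simp: mult_mat_vec[OF T])
    qed
    show "\<sigma> g *\<^sub>v x \<in> I" if g: "g \<in> carrier \<Gamma>" and x: "x \<in> I" for g x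
    proof -
      obtain a where "a \<in> carrier_vec n" "x = T *\<^sub>v a" using x by (auto simp: I_def)
      then show ?thesis
        unfolding I_def using \<rho>c[OF g]
        by (intro image_eqI[of _ _ "\<rho> g *\<^sub>v a"]) (auto simp: comm_vec[OF g])
    qed
  qed (use T in \<open>auto simp: I_def\<close>)
  moreover have "I \<noteq> {0\<^sub>v m}"
    using mat_eq_zeroI[OF T] nz by (auto simp: I_def)
  ultimately have surj: "\<exists>x \<in> carrier_vec n. T *\<^sub>v x = y" if "y \<in> carrier_vec m" for y
    using that unfolding I_def by (metis imageE)
  obtain S where S: "S \<in> carrier_mat n m" "T * S = 1\<^sub>m m"
    using surjective_imp_right_inverse[OF T surj] by blast
  have "m \<le> n" using injective_imp_dim_le[OF S(1) left_inverse_imp_injective[OF S(1) T S(2)]] .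
  moreover have "n \<le> m" using injective_imp_dim_le[OF T inj] .
  ultimately show ?thesis using inj by simp
qed

lemma schur_inequivalent:
  assumes \<Gamma>: "group \<Gamma>"
    and \<rho>: "irreducible_representation \<Gamma> n \<rho>" and \<sigma>: "irreducible_representation \<Gamma> m \<sigma>"
    and T: "T \<in> carrier_mat m n"
    and comm: "\<And>g. g \<in> carrier \<Gamma> \<Longrightarrow> T * \<rho> g = \<sigma> g * T"
    and "\<not> equivalent_representations \<Gamma> n \<rho> m \<sigma>"
  shows "T = 0\<^sub>m m n"
proof (rule ccontr)
  assume "T \<noteq> 0\<^sub>m m n"
  with schur_intertwiner[OF assms(1-5)] have mn: "m = n" and inj: "injective_matrix T" by auto
  obtain S where "S \<in> carrier_mat n n" "T * S = 1\<^sub>m n" "S * T = 1\<^sub>m n"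
    using square_injective_imp_inverse[OF inj] T mn by metis
  then have "T \<in> Units (ring_mat TYPE(complex) n ())"
    using T mn by (auto simp: Units_def ring_mat_simps)
  then show False using assms(6) mn comm unfolding equivalent_representations_def by auto
qed

text \<open>Subtracting an eigenvalue from \<open>T\<close> leaves an intertwiner with nonzero kernel, which
  vanishes because nonzero intertwiners are injective.\<close>

lemma schur_scalar:
  assumes \<Gamma>: "group \<Gamma>" and \<rho>: "irreducible_representation \<Gamma> n \<rho>"
    and T: "T \<in> carrier_mat n n"
    and comm: "\<And>g. g \<in> carrier \<Gamma> \<Longrightarrow> T * \<rho> g = \<rho> g * T"
  shows "\<exists>c. T = c \<cdot>\<^sub>m 1\<^sub>m n"
proof -
  have n: "n > 0" using \<rho> by (simp add: irreducible_representation_def)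
  have \<rho>c: "\<And>g. g \<in> carrier \<Gamma> \<Longrightarrow> \<rho> g \<in> carrier_mat n n"
    using \<rho> \<Gamma> by (auto simp: irreducible_representation_def representation_carrier)
  obtain c v where "eigenvector T v c"
    using spectrum_non_empty[OF T n] unfolding spectrum_def eigenvalue_def by auto
  then have v: "v \<in> carrier_vec n" "v \<noteq> 0\<^sub>v n" "char_matrix T c *\<^sub>v v = 0\<^sub>v n"
    using eigenvector_char_matrix[OF T] by auto
  have Tc: "char_matrix T c = T + (- c) \<cdot>\<^sub>m 1\<^sub>m n" using T by (simp add: char_matrix_def)
  have M: "char_matrix T c \<in> carrier_mat n n" using T by simp
  have "char_matrix T c * \<rho> g = \<rho> g * char_matrix T c" if g: "g \<in> carrier \<Gamma>" for g
  proof -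
    have sc: "(- c) \<cdot>\<^sub>m 1\<^sub>m n \<in> carrier_mat n n" by simp
    show ?thesis
      unfolding Tc add_mult_distrib_mat[OF T sc \<rho>c[OF g]] mult_add_distrib_mat[OF \<rho>c[OF g] T sc]
        comm[OF g]
      using \<rho>c[OF g] mult_smult_distrib[OF \<rho>c[OF g] one_carrier_mat]
        mult_smult_assoc_mat[OF one_carrier_mat \<rho>c[OF g]] by simp
  qed
  then have "char_matrix T c = 0\<^sub>m n n"
    using schur_intertwiner[OF \<Gamma> \<rho> \<rho> M] injective_matrixD[OF _ M v(1,3)] v(2) by blast
  then have "T = c \<cdot>\<^sub>m 1\<^sub>m n"
  proof (intro eq_matI)
    fix i j assume "i < dim_row (c \<cdot>\<^sub>m 1\<^sub>m n)" "j < dim_col (c \<cdot>\<^sub>m 1\<^sub>m n)"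
    then have ij: "i < n" "j < n" by auto
    assume "char_matrix T c = 0\<^sub>m n n"
    from arg_cong[OF this, of "\<lambda>A. A $$ (i, j)"] show "T $$ (i, j) = (c \<cdot>\<^sub>m 1\<^sub>m n) $$ (i, j)"
      using ij T unfolding Tc by (simp split: if_splits)
  qed (use T in auto)
  then show ?thesis ..
qed

text \<open>\<open>T\<close> is \<open>\<Sum>\<^sub>g \<sigma>(g\<inverse>) E\<^sub>b\<^sub>c \<rho>(g)\<close> for the matrix unit \<open>E\<^sub>b\<^sub>c\<close>. Averaging over the group turns any
  matrix into an intertwiner, by the substitution \<open>g \<mapsto> g x\<close>; matrix units are the case that
  isolates products of single coefficients.\<close>

lemma averaged_intertwiner:
  fixes \<sigma> \<rho> :: "'g \<Rightarrow> complex mat"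
  assumes \<Gamma>: "group \<Gamma>"
    and \<rho>: "representation \<Gamma> n \<rho>" and \<sigma>: "representation \<Gamma> m \<sigma>"
    and b: "b < m" and c: "c < n"
  defines "T \<equiv> mat m n (\<lambda>(a, d). \<Sum>g \<in> carrier \<Gamma>. \<sigma> (inv\<^bsub>\<Gamma>\<^esub> g) $$ (a, b) * \<rho> g $$ (c, d))"
  assumes x: "x \<in> carrier \<Gamma>"
  shows "T * \<rho> x = \<sigma> x * T"
proof (rule eq_matI)
  interpret group \<Gamma> by fact
  have \<rho>c: "\<rho> g \<in> carrier_mat n n" if "g \<in> carrier \<Gamma>" for g
    using representation_carrier[OF \<Gamma> \<rho> that] .
  have \<sigma>c: "\<sigma> g \<in> carrier_mat m m" if "g \<in> carrier \<Gamma>" for g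
    using representation_carrier[OF \<Gamma> \<sigma> that] .
  have T: "T \<in> carrier_mat m n" by (simp add: T_def)
  fix a d assume "a < dim_row (\<sigma> x * T)" "d < dim_col (\<sigma> x * T)"
  then have a: "a < m" and d: "d < n" using T \<sigma>c[OF x] by auto
  have "(T * \<rho> x) $$ (a, d) =
      (\<Sum>l<n. \<Sum>g \<in> carrier \<Gamma>. \<sigma> (inv\<^bsub>\<Gamma>\<^esub> g) $$ (a, b) * (\<rho> g $$ (c, l) * \<rho> x $$ (l, d)))"
    using a d by (simp add: index_mult_mat_sum[OF T \<rho>c[OF x]])
      (simp add: T_def sum_distrib_right mult.assoc)
  also have "\<dots> = (\<Sum>g \<in> carrier \<Gamma>. \<Sum>l<n. \<sigma> (inv\<^bsub>\<Gamma>\<^esub> g) $$ (a, b) * (\<rho> g $$ (c, l) * \<rho> x $$ (l, d)))"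
    by (rule sum.swap)
  also have "\<dots> = (\<Sum>g \<in> carrier \<Gamma>. \<sigma> (inv\<^bsub>\<Gamma>\<^esub> g) $$ (a, b) * \<rho> (g \<otimes>\<^bsub>\<Gamma>\<^esub> x) $$ (c, d))"
    using x c d by (intro sum.cong)
      (simp_all add: representation_mult[OF \<Gamma> \<rho>] index_mult_mat_sum[OF \<rho>c \<rho>c] sum_distrib_left
        del: index_mult_mat)
  also have "\<dots> = (\<Sum>g \<in> carrier \<Gamma>. \<sigma> (x \<otimes>\<^bsub>\<Gamma>\<^esub> inv\<^bsub>\<Gamma>\<^esub> g) $$ (a, b) * \<rho> g $$ (c, d))"
    using x by (intro sum.reindex_bij_witness[of _ "\<lambda>g. g \<otimes>\<^bsub>\<Gamma>\<^esub> inv\<^bsub>\<Gamma>\<^esub> x" "\<lambda>g. g \<otimes>\<^bsub>\<Gamma>\<^esub> x"])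
      (auto simp: m_assoc inv_mult_group simp flip: m_assoc[of x "inv\<^bsub>\<Gamma>\<^esub> x"])
  also have "\<dots> = (\<Sum>g \<in> carrier \<Gamma>. \<Sum>l<m. \<sigma> x $$ (a, l) * (\<sigma> (inv\<^bsub>\<Gamma>\<^esub> g) $$ (l, b) * \<rho> g $$ (c, d)))"
    using x a b by (intro sum.cong)
      (simp_all add: representation_mult[OF \<Gamma> \<sigma>] index_mult_mat_sum[OF \<sigma>c \<sigma>c] sum_distrib_right
        mult.assoc del: index_mult_mat)
  also have "\<dots> = (\<Sum>l<m. \<Sum>g \<in> carrier \<Gamma>. \<sigma> x $$ (a, l) * (\<sigma> (inv\<^bsub>\<Gamma>\<^esub> g) $$ (l, b) * \<rho> g $$ (c, d)))"
    by (rule sum.swap)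
  also have "\<dots> = (\<sigma> x * T) $$ (a, d)"
    using a d by (simp add: index_mult_mat_sum[OF \<sigma>c[OF x] T])
      (simp add: T_def sum_distrib_left)
  finally show "(T * \<rho> x) $$ (a, d) = (\<sigma> x * T) $$ (a, d)" .
qed (use representation_carrier[OF \<Gamma> \<rho> x] representation_carrier[OF \<Gamma> \<sigma> x] in \<open>auto simp: T_def\<close>)

lemma schur_orthogonality_inequivalent:
  assumes \<Gamma>: "group \<Gamma>"
    and \<rho>: "irreducible_representation \<Gamma> n \<rho>" and \<sigma>: "irreducible_representation \<Gamma> m \<sigma>"
    and ne: "\<not> equivalent_representations \<Gamma> n \<rho> m \<sigma>"
    and "a < m" "b < m" "c < n" "d < n"
  shows "(\<Sum>g \<in> carrier \<Gamma>. \<sigma> (inv\<^bsub>\<Gamma>\<^esub> g) $$ (a, b) * \<rho> g $$ (c, d)) = 0"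
proof -
  have "representation \<Gamma> n \<rho>" "representation \<Gamma> m \<sigma>"
    using \<rho> \<sigma> by (auto simp: irreducible_representation_def)
  from schur_inequivalent[OF \<Gamma> \<rho> \<sigma> mat_carrier averaged_intertwiner[OF \<Gamma> this \<open>b < m\<close> \<open>c < n\<close>] ne]
  have "mat m n (\<lambda>(a, d). \<Sum>g \<in> carrier \<Gamma>. \<sigma> (inv\<^bsub>\<Gamma>\<^esub> g) $$ (a, b) * \<rho> g $$ (c, d)) = 0\<^sub>m m n" .
  from arg_cong[OF this, of "\<lambda>A. A $$ (a, d)"] show ?thesis using assms by simp
qed

text \<open>By Schur's lemma the averaged intertwiner is a scalar \<open>t\<close>. Its trace determines \<open>t\<close>: it is
  \<open>n t\<close> on the one hand, and on the other each of the \<open>|\<Gamma>|\<close> summands contributes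
  \<open>(\<rho>(g) \<rho>(g\<inverse>))\<^sub>c\<^sub>b = \<delta>\<^sub>c\<^sub>b\<close>.\<close>

lemma schur_orthogonality_same:
  assumes \<Gamma>: "group \<Gamma>"
    and \<rho>: "irreducible_representation \<Gamma> n \<rho>"
    and a: "a < n" and b: "b < n" and c: "c < n" and d: "d < n"
  shows "(\<Sum>g \<in> carrier \<Gamma>. \<rho> (inv\<^bsub>\<Gamma>\<^esub> g) $$ (a, b) * \<rho> g $$ (c, d)) =
    (if a = d \<and> b = c then of_nat (card (carrier \<Gamma>)) / of_nat n else 0)"
proof -
  interpret group \<Gamma> by fact
  have rep: "representation \<Gamma> n \<rho>"
    using \<rho> by (auto simp: irreducible_representation_def)
  let ?f = "\<lambda>a d. \<Sum>g \<in> carrier \<Gamma>. \<rho> (inv\<^bsub>\<Gamma>\<^esub> g) $$ (a, b) * \<rho> g $$ (c, d)"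
  obtain t where t: "mat n n (\<lambda>(a, d). ?f a d) = t \<cdot>\<^sub>m 1\<^sub>m n"
    using schur_scalar[OF \<Gamma> \<rho> mat_carrier averaged_intertwiner[OF \<Gamma> rep rep b c]] by blast
  have f: "?f i j = (if i = j then t else 0)" if "i < n" "j < n" for i j
    using arg_cong[OF t, of "\<lambda>A. A $$ (i, j)"] that by simp
  have "of_nat n * t = (\<Sum>i<n. ?f i i)" by (simp add: f)
  also have "\<dots> = (\<Sum>g \<in> carrier \<Gamma>. \<Sum>i<n. \<rho> (inv\<^bsub>\<Gamma>\<^esub> g) $$ (i, b) * \<rho> g $$ (c, i))"
    by (rule sum.swap)
  also have "\<dots> = (\<Sum>g \<in> carrier \<Gamma>. (\<rho> g * \<rho> (inv\<^bsub>\<Gamma>\<^esub> g)) $$ (c, b))"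
    using b c by (intro sum.cong)
      (simp_all add: index_mult_mat_sum[OF representation_carrier[OF \<Gamma> rep] representation_carrier[OF \<Gamma> rep]]
        mult.commute del: index_mult_mat)
  also have "\<dots> = (\<Sum>g \<in> carrier \<Gamma>. if b = c then 1 else 0)"
    using b c by (intro sum.cong)
      (auto simp flip: representation_mult[OF \<Gamma> rep] simp: representation_one[OF \<Gamma> rep])
  finally have "t = (if b = c then of_nat (card (carrier \<Gamma>)) / of_nat n else 0)"
    using a by (auto simp: field_simps)
  then show ?thesis using f[OF a d] by auto
qed

lemma irreducible_coefficients_orthogonal:
  assumes \<Gamma>: "group \<Gamma>"
    and irr: "complete_irreducibles \<Gamma> k d \<rho>"
    and i: "i \<in> {1..k}" and j: "j \<in> {1..k}"
    and bounds: "a < d i" "b < d i" "a' < d j" "b' < d j"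
  shows "(\<Sum>g \<in> carrier \<Gamma>. \<rho> i (inv\<^bsub>\<Gamma>\<^esub> g) $$ (b, a) * \<rho> j g $$ (a', b')) =
    (if i = j \<and> a = a' \<and> b = b' then of_nat (card (carrier \<Gamma>)) / of_nat (d i) else 0)"
proof -
  have irrD: "irreducible_representation \<Gamma> (d j) (\<rho> j)" if "j \<in> {1..k}" for j
    using irr that by (auto simp: complete_irreducibles_def)
  show ?thesis
  proof (cases "i = j")
    case True
    then show ?thesis
      using schur_orthogonality_same[OF \<Gamma> irrD[OF i], of b a a' b'] bounds by auto
  next
    case False
    then have "\<not> equivalent_representations \<Gamma> (d j) (\<rho> j) (d i) (\<rho> i)"
      using irr i j by (simp add: complete_irreducibles_def)
    then show ?thesis
      using schur_orthogonality_inequivalent[OF \<Gamma> irrD[OF j] irrD[OF i], of b a a' b']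
        False bounds by simp
  qed
qed

section \<open>Completeness of the matrix coefficients\<close>

text \<open>Let \<open>N\<close> be the space of functions whose conjugate is annihilated by all \<open>\<rho>\<^sub>j\<close>, that is, the
  orthogonal complement of all matrix coefficients. It is invariant under the right translations
  \<open>R\<close> and contains the conjugate of \<open>f\<close>. If it were nonzero, a nonzero invariant subspace of minimal
  dimension, with basis matrix \<open>F\<close>, would carry a representation \<open>\<sigma>\<close> with \<open>R(x) F = F \<sigma>(x)\<close>, which is
  irreducible by minimality. Reading that equation in the row of the group identity shows
  \<open>F(g, b) = \<Sum>\<^sub>a F(1, a) \<sigma>(g)\<^sub>a\<^sub>b\<close>, so the columns of \<open>F\<close> are combinations of coefficients of the
  \<open>\<rho>\<^sub>i\<close> equivalent to \<open>\<sigma>\<close>. As they also lie in \<open>N\<close>, they are orthogonal to themselves.\<close>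

lemma irreducible_coefficients_separate:
  fixes f :: "'g \<Rightarrow> complex"
  assumes \<Gamma>: "group \<Gamma>" and fin: "finite (carrier \<Gamma>)"
    and irr: "complete_irreducibles \<Gamma> k d \<rho>"
    and f: "\<And>j a b. j \<in> {1..k} \<Longrightarrow> a < d j \<Longrightarrow> b < d j \<Longrightarrow>
      (\<Sum>g \<in> carrier \<Gamma>. f g * \<rho> j g $$ (a, b)) = 0"
    and y: "y \<in> carrier \<Gamma>"
  shows "f y = 0"
proof (rule ccontr)
  assume fy: "f y \<noteq> 0"
  interpret group \<Gamma> by fact
  have rep: "representation \<Gamma> (d j) (\<rho> j)" if "j \<in> {1..k}" for j
    using irr that by (auto simp: complete_irreducibles_def irreducible_representation_def)
  define p where "p = card (carrier \<Gamma>)"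
  obtain e where e: "bij_betw e {0..<p} (carrier \<Gamma>)"
    using ex_bij_betw_nat_finite[OF fin] unfolding p_def by blast
  \<comment> \<open>The group is numbered by \<open>e\<close>, with inverse \<open>idx\<close>, so that functions on it become vectors of length \<open>p\<close>.\<close>
  define idx where "idx = the_inv_into {0..<p} e"
  have e_car: "e i \<in> carrier \<Gamma>" if "i < p" for i
    using e that by (auto dest: bij_betwE)
  have idx_e: "idx (e i) = i" if "i < p" for i
    using e that by (simp add: idx_def the_inv_into_f_f bij_betw_imp_inj_on)
  have e_idx: "e (idx g) = g" "idx g < p" if "g \<in> carrier \<Gamma>" for g
    using e that f_the_inv_into_f_bij_betw[OF e] bij_betwE[OF bij_betw_the_inv_into[OF e]]
    by (auto simp: idx_def)
  define R where "R = (\<lambda>x. mat p p (\<lambda>(i, l). if l = idx (e i \<otimes>\<^bsub>\<Gamma>\<^esub> x) then 1 else 0 :: complex))"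
  have R: "R x \<in> carrier_mat p p" for x by (simp add: R_def)
  have R_vec: "(R x *\<^sub>v v) $ i = v $ idx (e i \<otimes>\<^bsub>\<Gamma>\<^esub> x)"
    if "x \<in> carrier \<Gamma>" "v \<in> carrier_vec p" "i < p" for x v i
    unfolding index_mult_mat_vec_sum[OF R that(2,3)] using that e_idx(2)[of "e i \<otimes>\<^bsub>\<Gamma>\<^esub> x"] e_car
    by (simp add: R_def if_distrib[of "\<lambda>z. z * _"] cong: if_cong)
  have R_mat: "(R x * A) $$ (i, b) = A $$ (idx (e i \<otimes>\<^bsub>\<Gamma>\<^esub> x), b)"
    if "x \<in> carrier \<Gamma>" "A \<in> carrier_mat p r" "i < p" "b < r" for x A r i b
    unfolding index_mult_mat_sum[OF R that(2,3,4)] using that e_idx(2)[of "e i \<otimes>\<^bsub>\<Gamma>\<^esub> x"] e_car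
    by (simp add: R_def if_distrib[of "\<lambda>z. z * _"] cong: if_cong)
  have R_mult: "R (x \<otimes>\<^bsub>\<Gamma>\<^esub> z) = R x * R z" if x: "x \<in> carrier \<Gamma>" and z: "z \<in> carrier \<Gamma>" for x z
  proof (rule eq_matI)
    fix i l assume "i < dim_row (R x * R z)" "l < dim_col (R x * R z)"
    then have il: "i < p" "l < p" by (auto simp: R_def)
    then show "R (x \<otimes>\<^bsub>\<Gamma>\<^esub> z) $$ (i, l) = (R x * R z) $$ (i, l)"
      unfolding R_mat[OF x R il] using x z e_car[OF il(1)] e_idx by (simp add: R_def m_assoc)
  qed (auto simp: R_def)
  have R_one: "R \<one>\<^bsub>\<Gamma>\<^esub> = 1\<^sub>m p"
    by (rule eq_matI) (auto simp: R_def e_car idx_e)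
  define N where "N = {v \<in> carrier_vec p. \<forall>j \<in> {1..k}. \<forall>a < d j. \<forall>b < d j.
    (\<Sum>g \<in> carrier \<Gamma>. cnj (v $ idx g) * \<rho> j g $$ (a, b)) = 0}"
  have N_inv: "R x *\<^sub>v v \<in> N" if x: "x \<in> carrier \<Gamma>" and v: "v \<in> N" for x v
  proof -
    have vc: "v \<in> carrier_vec p" using v by (simp add: N_def)
    have "(\<Sum>g \<in> carrier \<Gamma>. cnj ((R x *\<^sub>v v) $ idx g) * \<rho> j g $$ (a, b)) = 0"
      if j: "j \<in> {1..k}" and a: "a < d j" and b: "b < d j" for j a b
    proof -
      note car = representation_carrier[OF \<Gamma> rep[OF j]]
      have "(\<Sum>g \<in> carrier \<Gamma>. cnj ((R x *\<^sub>v v) $ idx g) * \<rho> j g $$ (a, b)) =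
          (\<Sum>g \<in> carrier \<Gamma>. cnj (v $ idx (g \<otimes>\<^bsub>\<Gamma>\<^esub> x)) * \<rho> j g $$ (a, b))"
        by (intro sum.cong) (simp_all add: R_vec[OF x vc] e_idx)
      also have "\<dots> = (\<Sum>g \<in> carrier \<Gamma>. cnj (v $ idx g) * \<rho> j (g \<otimes>\<^bsub>\<Gamma>\<^esub> inv\<^bsub>\<Gamma>\<^esub> x) $$ (a, b))"
        using x by (intro sum.reindex_bij_witness[of _ "\<lambda>g. g \<otimes>\<^bsub>\<Gamma>\<^esub> inv\<^bsub>\<Gamma>\<^esub> x" "\<lambda>g. g \<otimes>\<^bsub>\<Gamma>\<^esub> x"])
          (auto simp: m_assoc)
      also have "\<dots> = (\<Sum>g \<in> carrier \<Gamma>. \<Sum>c<d j.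
          (cnj (v $ idx g) * \<rho> j g $$ (a, c)) * \<rho> j (inv\<^bsub>\<Gamma>\<^esub> x) $$ (c, b))"
        using x a b by (intro sum.cong) (simp_all add: representation_mult[OF \<Gamma> rep[OF j]]
          index_mult_mat_sum[OF car car] sum_distrib_left mult.assoc del: index_mult_mat)
      also have "\<dots> = (\<Sum>c<d j. (\<Sum>g \<in> carrier \<Gamma>. cnj (v $ idx g) * \<rho> j g $$ (a, c)) *
          \<rho> j (inv\<^bsub>\<Gamma>\<^esub> x) $$ (c, b))"
        by (subst sum.swap) (simp add: sum_distrib_right)
      also have "\<dots> = 0" using v j a by (simp add: N_def)
      finally show ?thesis .
    qed
    then show ?thesis using R[of x] vc by (simp add: N_def)
  qed
  \<comment> \<open>\<open>P r\<close>: the space \<open>N\<close> has an invariant subspace of dimension \<open>r > 0\<close>, given by a basis matrix.\<close>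
  define P where "P = (\<lambda>r. r > 0 \<and> (\<exists>F \<in> carrier_mat p r. injective_matrix F \<and>
    (\<forall>v \<in> carrier_vec r. F *\<^sub>v v \<in> N) \<and>
    (\<forall>x \<in> carrier \<Gamma>. \<forall>v \<in> carrier_vec r. \<exists>w \<in> carrier_vec r. R x *\<^sub>v (F *\<^sub>v v) = F *\<^sub>v w)))"
  have "\<exists>r. P r"
  proof -
    have "N \<subseteq> carrier_vec p" "0\<^sub>v p \<in> N" by (auto simp: N_def e_idx)
    moreover have "v + w \<in> N" if "v \<in> N" "w \<in> N" for v w
    proof -
      have "v \<in> carrier_vec p" "w \<in> carrier_vec p" using that by (auto simp: N_def)
      then have "(v + w) $ idx g = v $ idx g + w $ idx g" if "g \<in> carrier \<Gamma>" for g
        using e_idx(2)[OF that] by simp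
      then show ?thesis using that by (simp add: N_def distrib_right sum.distrib)
    qed
    moreover have "c \<cdot>\<^sub>v v \<in> N" if "v \<in> N" for c v
    proof -
      have "v \<in> carrier_vec p" using that by (simp add: N_def)
      then have "(c \<cdot>\<^sub>v v) $ idx g = c * v $ idx g" if "g \<in> carrier \<Gamma>" for g
        using e_idx(2)[OF that] by simp
      then show ?thesis using that by (simp add: N_def mult.assoc flip: sum_distrib_left)
    qed
    ultimately obtain r F where F: "F \<in> carrier_mat p r" "injective_matrix F"
      "N = (\<lambda>v. F *\<^sub>v v) ` carrier_vec r"
      by (rule subspace_basis_matrix)
    \<comment> \<open>The conjugate of \<open>f\<close> shows that \<open>N\<close> is nonzero.\<close>
    let ?u = "vec p (\<lambda>i. cnj (f (e i)))"
    have u: "?u \<in> N" using f by (simp add: N_def e_idx)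
    have "r \<noteq> 0"
    proof
      assume "r = 0"
      then have "?u = 0\<^sub>v p" using u F by (auto simp: scalar_prod_def intro!: eq_vecI)
      from arg_cong[OF this, of "\<lambda>v. v $ idx y"] show False using fy y e_idx by simp
    qed
    then have "P r" unfolding P_def using F N_inv by (auto intro!: bexI[of _ F])
    then show ?thesis ..
  qed
  define r where "r = (LEAST r. P r)"
  have "P r" using \<open>\<exists>r. P r\<close> unfolding r_def by (rule LeastI_ex)
  have least: "r \<le> s" if "P s" for s using that unfolding r_def by (rule Least_le)
  from \<open>P r\<close> obtain F where r: "r > 0" and F: "F \<in> carrier_mat p r" and inj: "injective_matrix F"
    and FN: "\<And>v. v \<in> carrier_vec r \<Longrightarrow> F *\<^sub>v v \<in> N"
    and F_inv: "\<And>x v. x \<in> carrier \<Gamma> \<Longrightarrow> v \<in> carrier_vec r \<Longrightarrow>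
      \<exists>w \<in> carrier_vec r. R x *\<^sub>v (F *\<^sub>v v) = F *\<^sub>v w"
    unfolding P_def by blast
  have "\<exists>S \<in> carrier_mat r r. R x * F = F * S" if x: "x \<in> carrier \<Gamma>" for x
    using F_inv[OF x] F R[of x] by (intro columnwise_factorization[OF _ F]) auto
  then obtain \<sigma> where \<sigma>: "\<And>x. x \<in> carrier \<Gamma> \<Longrightarrow> \<sigma> x \<in> carrier_mat r r"
    and RF: "\<And>x. x \<in> carrier \<Gamma> \<Longrightarrow> R x * F = F * \<sigma> x"
    by metis
  have \<sigma>_rep: "representation \<Gamma> r \<sigma>"
  proof (rule representationI[OF \<Gamma> \<sigma>])
    fix g h assume g: "g \<in> carrier \<Gamma>" and h: "h \<in> carrier \<Gamma>"
    have "F * \<sigma> (g \<otimes>\<^bsub>\<Gamma>\<^esub> h) = R g * R h * F" using g h RF R_mult by (metis m_closed)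
    also have "\<dots> = R g * (F * \<sigma> h)" using RF[OF h] assoc_mult_mat[OF R R F] by simp
    also have "\<dots> = F * \<sigma> g * \<sigma> h" using RF[OF g] assoc_mult_mat[OF R F \<sigma>[OF h]] by metis
    also have "\<dots> = F * (\<sigma> g * \<sigma> h)" by (rule assoc_mult_mat[OF F \<sigma>[OF g] \<sigma>[OF h]])
    finally show "\<sigma> (g \<otimes>\<^bsub>\<Gamma>\<^esub> h) = \<sigma> g * \<sigma> h"
      using g h \<sigma>[OF g] \<sigma>[OF h] by (intro injective_mult_cancel[OF inj F \<sigma>]) auto
  next
    have "F * \<sigma> \<one>\<^bsub>\<Gamma>\<^esub> = F * 1\<^sub>m r" using RF[OF one_closed] R_one F by simp
    then show "\<sigma> \<one>\<^bsub>\<Gamma>\<^esub> = 1\<^sub>m r" by (intro injective_mult_cancel[OF inj F \<sigma>]) auto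
  qed
  have "irreducible_representation \<Gamma> r \<sigma>"
    unfolding irreducible_representation_def
  proof (intro conjI allI impI \<sigma>_rep r)
    fix U assume "VectorSpace.subspace class_ring U (module_vec TYPE(complex) r) \<and>
      (\<forall>g \<in> carrier \<Gamma>. \<forall>x \<in> U. \<sigma> g *\<^sub>v x \<in> U)"
    then have U: "U \<subseteq> carrier_vec r" "0\<^sub>v r \<in> U" "\<And>x y. x \<in> U \<Longrightarrow> y \<in> U \<Longrightarrow> x + y \<in> U"
      "\<And>c x. x \<in> U \<Longrightarrow> c \<cdot>\<^sub>v x \<in> U"
      and U_inv: "\<And>g x. g \<in> carrier \<Gamma> \<Longrightarrow> x \<in> U \<Longrightarrow> \<sigma> g *\<^sub>v x \<in> U"
      unfolding subspace_module_vec_iff by auto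
    from U obtain s B where B: "B \<in> carrier_mat r s" and B_inj: "injective_matrix B"
      and U_eq: "U = (\<lambda>v. B *\<^sub>v v) ` carrier_vec s"
      by (rule subspace_basis_matrix)
    show "U = {0\<^sub>v r} \<or> U = carrier_vec r"
    proof (cases "s = 0")
      case True
      then have "B *\<^sub>v v = 0\<^sub>v r" if "v \<in> carrier_vec s" for v
        using B that by (intro eq_vecI) (auto simp: scalar_prod_def)
      then have "U = {0\<^sub>v r}" using U_eq U(2) by auto
      then show ?thesis ..
    next
      case False
      have FB: "F * B \<in> carrier_mat p s" using F B by simp
      have FBv: "F * B *\<^sub>v v = F *\<^sub>v (B *\<^sub>v v)" if "v \<in> carrier_vec s" for v
        using assoc_mult_mat_vec[OF F B that] .
      have "P s" unfolding P_def
      proof (intro conjI bexI[OF _ FB] ballI)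
        show "s > 0" using False by simp
        show "injective_matrix (F * B)"
        proof (rule injective_matrixI[OF FB])
          fix v assume v: "v \<in> carrier_vec s" and "F * B *\<^sub>v v = 0\<^sub>v p"
          then have "B *\<^sub>v v = 0\<^sub>v r"
            using FBv[OF v] by (intro injective_matrixD[OF inj F mult_mat_vec_carrier[OF B v]]) simp
          then show "v = 0\<^sub>v s" by (rule injective_matrixD[OF B_inj B v])
        qed
        show "F * B *\<^sub>v v \<in> N" if v: "v \<in> carrier_vec s" for v
          unfolding FBv[OF v] by (rule FN[OF mult_mat_vec_carrier[OF B v]])
        fix x and v :: "complex vec" assume x: "x \<in> carrier \<Gamma>" and v: "v \<in> carrier_vec s"
        have Bv: "B *\<^sub>v v \<in> carrier_vec r" by (rule mult_mat_vec_carrier[OF B v])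
        have "\<sigma> x *\<^sub>v (B *\<^sub>v v) \<in> U" using U_inv[OF x] v U_eq by blast
        then obtain w where w: "w \<in> carrier_vec s" "\<sigma> x *\<^sub>v (B *\<^sub>v v) = B *\<^sub>v w"
          using U_eq by auto
        have "R x *\<^sub>v (F * B *\<^sub>v v) = (R x * F) *\<^sub>v (B *\<^sub>v v)"
          unfolding FBv[OF v] by (rule assoc_mult_mat_vec[OF R F Bv, symmetric])
        also have "\<dots> = F *\<^sub>v (\<sigma> x *\<^sub>v (B *\<^sub>v v))"
          unfolding RF[OF x] by (rule assoc_mult_mat_vec[OF F \<sigma>[OF x] Bv])
        also have "\<dots> = F * B *\<^sub>v w" by (simp add: w FBv)
        finally show "\<exists>w \<in> carrier_vec s. R x *\<^sub>v (F * B *\<^sub>v v) = F * B *\<^sub>v w"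
          using w(1) by blast
      qed
      then have "s = r" using least[of s] injective_imp_dim_le[OF B B_inj] by simp
      then show ?thesis using range_of_square_injective[OF B_inj] B U_eq by simp
    qed
  qed
  then obtain i where i: "i \<in> {1..k}" and eqv: "equivalent_representations \<Gamma> r \<sigma> (d i) (\<rho> i)"
    using irr unfolding complete_irreducibles_def by blast
  then have di: "d i = r" by (simp add: equivalent_representations_def)
  obtain T T' where T: "T \<in> carrier_mat r r" and T': "T' \<in> carrier_mat r r" and T'T: "T' * T = 1\<^sub>m r"
    and comm: "\<And>g. g \<in> carrier \<Gamma> \<Longrightarrow> \<rho> i g * T = T * \<sigma> g"
    using eqv unfolding equivalent_representations_def Units_def ring_mat_simps by blast
  have \<rho>c: "\<rho> i g \<in> carrier_mat r r" if "g \<in> carrier \<Gamma>" for g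
    using representation_carrier[OF \<Gamma> rep[OF i] that] di by simp
  have \<sigma>_eq: "\<sigma> g = T' * (\<rho> i g * T)" if g: "g \<in> carrier \<Gamma>" for g
    unfolding comm[OF g] assoc_mult_mat[OF T' T \<sigma>[OF g], symmetric] T'T using \<sigma>[OF g] by simp
  \<comment> \<open>Evaluation at the group identity is the entry with index \<open>i0\<close>.\<close>
  define i0 where "i0 = idx \<one>\<^bsub>\<Gamma>\<^esub>"
  have i0: "i0 < p" "e i0 = \<one>\<^bsub>\<Gamma>\<^esub>" by (auto simp: i0_def e_idx)
  have FT': "F * T' \<in> carrier_mat p r" using F T' by simp
  have F_eq: "F $$ (idx g, 0) =
      (\<Sum>a<r. \<Sum>b<r. (F * T') $$ (i0, a) * (\<rho> i g $$ (a, b) * T $$ (b, 0)))"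
    if g: "g \<in> carrier \<Gamma>" for g
  proof -
    have "F $$ (idx g, 0) = (R g * F) $$ (i0, 0)"
      unfolding R_mat[OF g F i0(1) r] using i0 g by simp
    also have "R g * F = F * T' * (\<rho> i g * T)"
      unfolding RF[OF g] \<sigma>_eq[OF g]
      by (rule assoc_mult_mat[OF F T' mult_carrier_mat[OF \<rho>c[OF g] T], symmetric])
    also have "\<dots> $$ (i0, 0) = (\<Sum>a<r. (F * T') $$ (i0, a) * (\<rho> i g * T) $$ (a, 0))"
      by (rule index_mult_mat_sum[OF FT' mult_carrier_mat[OF \<rho>c[OF g] T] i0(1) r])
    also have "\<dots> = (\<Sum>a<r. \<Sum>b<r. (F * T') $$ (i0, a) * (\<rho> i g $$ (a, b) * T $$ (b, 0)))"
      using r by (intro sum.cong)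
        (simp_all add: index_mult_mat_sum[OF \<rho>c[OF g] T] sum_distrib_left del: index_mult_mat)
    finally show ?thesis .
  qed
  have "F *\<^sub>v unit_vec r 0 \<in> N" by (rule FN) simp
  moreover have "(F *\<^sub>v unit_vec r 0) $ idx g = F $$ (idx g, 0)" if "g \<in> carrier \<Gamma>" for g
    using e_idx[OF that] F r by simp
  ultimately have F_orth: "(\<Sum>g \<in> carrier \<Gamma>. cnj (F $$ (idx g, 0)) * \<rho> i g $$ (a, b)) = 0"
    if "a < r" "b < r" for a b
    using that i di by (simp add: N_def)
  \<comment> \<open>The first column of \<open>F\<close> is a combination of coefficients to which it is orthogonal, so its norm is zero.\<close>
  have "(\<Sum>g \<in> carrier \<Gamma>. cnj (F $$ (idx g, 0)) * F $$ (idx g, 0)) =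
      (\<Sum>g \<in> carrier \<Gamma>. \<Sum>a<r. \<Sum>b<r. cnj (F $$ (idx g, 0)) *
        ((F * T') $$ (i0, a) * (\<rho> i g $$ (a, b) * T $$ (b, 0))))"
    by (intro sum.cong) (simp_all add: F_eq sum_distrib_left)
  also have "\<dots> = (\<Sum>a<r. \<Sum>b<r. \<Sum>g \<in> carrier \<Gamma>. cnj (F $$ (idx g, 0)) *
        ((F * T') $$ (i0, a) * (\<rho> i g $$ (a, b) * T $$ (b, 0))))"
    by (subst sum.swap, intro sum.cong refl, rule sum.swap)
  also have "\<dots> = (\<Sum>a<r. \<Sum>b<r. (F * T') $$ (i0, a) * T $$ (b, 0) *
      (\<Sum>g \<in> carrier \<Gamma>. cnj (F $$ (idx g, 0)) * \<rho> i g $$ (a, b)))"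
    by (intro sum.cong refl) (simp add: sum_distrib_left mult_ac)
  also have "\<dots> = 0" by (simp add: F_orth)
  finally have "(\<Sum>g \<in> carrier \<Gamma>. complex_of_real ((cmod (F $$ (idx g, 0)))\<^sup>2)) = 0"
    by (simp only: complex_norm_square mult.commute)
  then have "(\<Sum>g \<in> carrier \<Gamma>. (cmod (F $$ (idx g, 0)))\<^sup>2) = 0"
    by (simp only: of_real_eq_0_iff flip: of_real_sum)
  then have F0: "F $$ (idx g, 0) = 0" if "g \<in> carrier \<Gamma>" for g
    using that fin by (simp add: sum_nonneg_eq_0_iff)
  have "F *\<^sub>v unit_vec r 0 = 0\<^sub>v p"
  proof (rule eq_vecI)
    fix l assume "l < dim_vec (0\<^sub>v p)"
    then have l: "l < p" by simp
    then show "(F *\<^sub>v unit_vec r 0) $ l = 0\<^sub>v p $ l"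
      using F0[OF e_car[OF l]] F r by (simp add: idx_e)
  qed (use F in simp)
  then have "unit_vec r 0 = (0\<^sub>v r :: complex vec)"
    by (intro injective_matrixD[OF inj F]) auto
  from arg_cong[OF this, of "\<lambda>v. v $ 0"] show False using r by simp
qed

lemma sum_if_const: "(\<Sum>x \<in> A. if P then f x else 0) = (if P then \<Sum>x \<in> A. f x else 0)"
  by simp

text \<open>For fixed \<open>h\<close>, let \<open>r\<close> be the difference of the two sides as a function of \<open>g\<close>. Orthogonality
  makes \<open>\<Sum>\<^sub>g r(g) \<rho>\<^sub>i(g\<inverse>)\<close> vanish for every \<open>i\<close>, so \<open>g \<mapsto> r(g\<inverse>)\<close> is annihilated by all irreducible
  representations and hence zero.\<close>

lemma irreducible_coefficients_complete:
  assumes \<Gamma>: "group \<Gamma>" and fin: "finite (carrier \<Gamma>)"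
    and irr: "complete_irreducibles \<Gamma> k d \<rho>"
    and g: "g \<in> carrier \<Gamma>" and h: "h \<in> carrier \<Gamma>"
  shows "(\<Sum>j = 1..k. \<Sum>a<d j. \<Sum>b<d j. of_nat (d j) / of_nat (card (carrier \<Gamma>)) *
      (\<rho> j g $$ (a, b) * \<rho> j (inv\<^bsub>\<Gamma>\<^esub> h) $$ (b, a))) = (if g = h then 1 else 0)"
proof -
  interpret group \<Gamma> by fact
  define p where "p = card (carrier \<Gamma>)"
  have p: "p > 0" using fin g by (auto simp: p_def card_gt_0_iff)
  have d_pos: "d j > 0" if "j \<in> {1..k}" for j
    using irr that by (auto simp: complete_irreducibles_def irreducible_representation_def)
  define s where "s = (\<lambda>g. \<Sum>j = 1..k. \<Sum>a<d j. \<Sum>b<d j. of_nat (d j) / of_nat p *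
      (\<rho> j g $$ (a, b) * \<rho> j (inv\<^bsub>\<Gamma>\<^esub> h) $$ (b, a)))"
  define r where "r = (\<lambda>g. (if g = h then 1 else 0) - s g)"
  have "(\<Sum>x \<in> carrier \<Gamma>. r (inv\<^bsub>\<Gamma>\<^esub> x) * \<rho> i x $$ (c, e)) = 0"
    if i: "i \<in> {1..k}" and c: "c < d i" and e: "e < d i" for i c e
  proof -
    have "(\<Sum>x \<in> carrier \<Gamma>. r (inv\<^bsub>\<Gamma>\<^esub> x) * \<rho> i x $$ (c, e)) =
        (\<Sum>x \<in> carrier \<Gamma>. r x * \<rho> i (inv\<^bsub>\<Gamma>\<^esub> x) $$ (c, e))"
      by (intro sum.reindex_bij_witness[of _ "\<lambda>x. inv\<^bsub>\<Gamma>\<^esub> x" "\<lambda>x. inv\<^bsub>\<Gamma>\<^esub> x"]) auto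
    also have "\<dots> = (\<Sum>x \<in> carrier \<Gamma>. if x = h then \<rho> i (inv\<^bsub>\<Gamma>\<^esub> x) $$ (c, e) else 0) -
        (\<Sum>x \<in> carrier \<Gamma>. s x * \<rho> i (inv\<^bsub>\<Gamma>\<^esub> x) $$ (c, e))"
      unfolding sum_subtractf[symmetric] by (intro sum.cong) (auto simp: r_def left_diff_distrib)
    also have "(\<Sum>x \<in> carrier \<Gamma>. if x = h then \<rho> i (inv\<^bsub>\<Gamma>\<^esub> x) $$ (c, e) else 0) =
        \<rho> i (inv\<^bsub>\<Gamma>\<^esub> h) $$ (c, e)"
      using fin h by simp
    also have "(\<Sum>x \<in> carrier \<Gamma>. s x * \<rho> i (inv\<^bsub>\<Gamma>\<^esub> x) $$ (c, e)) =
        (\<Sum>x \<in> carrier \<Gamma>. \<Sum>j = 1..k. \<Sum>a<d j. \<Sum>b<d j. of_nat (d j) / of_nat p *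
          \<rho> j (inv\<^bsub>\<Gamma>\<^esub> h) $$ (b, a) * (\<rho> i (inv\<^bsub>\<Gamma>\<^esub> x) $$ (c, e) * \<rho> j x $$ (a, b)))"
      unfolding s_def sum_distrib_right by (intro sum.cong refl) (simp add: mult_ac)
    also have "\<dots> = (\<Sum>j = 1..k. \<Sum>a<d j. \<Sum>b<d j. \<Sum>x \<in> carrier \<Gamma>. of_nat (d j) / of_nat p *
          \<rho> j (inv\<^bsub>\<Gamma>\<^esub> h) $$ (b, a) * (\<rho> i (inv\<^bsub>\<Gamma>\<^esub> x) $$ (c, e) * \<rho> j x $$ (a, b)))"
      by (subst sum.swap, intro sum.cong refl, subst sum.swap, intro sum.cong refl, rule sum.swap)
    also have "\<dots> = (\<Sum>j = 1..k. \<Sum>a<d j. \<Sum>b<d j. if j = i then if a = e then if b = c then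
          of_nat (d j) / of_nat p * \<rho> j (inv\<^bsub>\<Gamma>\<^esub> h) $$ (b, a) * (of_nat p / of_nat (d i))
          else 0 else 0 else 0)"
      unfolding sum_distrib_left[symmetric] by (intro sum.cong refl) 
        (auto simp: irreducible_coefficients_orthogonal[OF \<Gamma> irr i _ e c, folded p_def])
    also have "\<dots> = (\<Sum>j = 1..k. if j = i then \<Sum>a<d j. if a = e then \<Sum>b<d j. if b = c then
          of_nat (d j) / of_nat p * \<rho> j (inv\<^bsub>\<Gamma>\<^esub> h) $$ (b, a) * (of_nat p / of_nat (d i))
          else 0 else 0 else 0)"
      by (simp only: sum_if_const)
    also have "\<dots> = of_nat (d i) / of_nat p * \<rho> i (inv\<^bsub>\<Gamma>\<^esub> h) $$ (c, e) * (of_nat p / of_nat (d i))"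
      using i c e by simp
    also have "\<dots> = \<rho> i (inv\<^bsub>\<Gamma>\<^esub> h) $$ (c, e)"
      using p d_pos[OF i] by simp
    finally show ?thesis by simp
  qed
  then have "r (inv\<^bsub>\<Gamma>\<^esub> (inv\<^bsub>\<Gamma>\<^esub> g)) = 0"
    by (rule irreducible_coefficients_separate[OF \<Gamma> fin irr]) (use g in auto)
  then show ?thesis using g by (simp add: r_def s_def p_def)
qed


section \<open>Matrices indexed by lists\<close>

text \<open>The rectangular counterpart of \<^const>\<open>matrix_of\<close>, needed because the base change has rows indexed
  by \<open>V \<times> \<Gamma>\<close> and columns indexed by coefficients.\<close>

definition index_matrix :: "'a list \<Rightarrow> 'b list \<Rightarrow> ('a \<Rightarrow> 'b \<Rightarrow> complex) \<Rightarrow> complex mat" where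
  "index_matrix xs ys f = mat (length xs) (length ys) (\<lambda>(i, j). f (xs ! i) (ys ! j))"

lemma index_matrix_carrier: "index_matrix xs ys f \<in> carrier_mat (length xs) (length ys)"
  by (simp add: index_matrix_def)

lemma matrix_of_eq_index_matrix: "matrix_of xs f = index_matrix xs xs f"
  by (simp add: matrix_of_def index_matrix_def)

lemma index_matrix_cong:
  assumes "\<And>x y. x \<in> set xs \<Longrightarrow> y \<in> set ys \<Longrightarrow> f x y = g x y"
  shows "index_matrix xs ys f = index_matrix xs ys g"
  using assms by (auto simp: index_matrix_def intro!: eq_matI)

lemma index_matrix_mult:
  assumes "distinct ys"
  shows "index_matrix xs ys f * index_matrix ys zs g =
    index_matrix xs zs (\<lambda>x z. \<Sum>y \<in> set ys. f x y * g y z)"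
proof (rule eq_matI)
  fix i j
  let ?h = "\<lambda>x z. \<Sum>y \<in> set ys. f x y * g y z"
  assume "i < dim_row (index_matrix xs zs ?h)" "j < dim_col (index_matrix xs zs ?h)"
  then have ij: "i < length xs" "j < length zs" by (auto simp: index_matrix_def)
  have "(index_matrix xs ys f * index_matrix ys zs g) $$ (i, j) =
      (\<Sum>l<length ys. f (xs ! i) (ys ! l) * g (ys ! l) (zs ! j))"
    unfolding index_mult_mat_sum[OF index_matrix_carrier index_matrix_carrier ij]
    using ij by (simp add: index_matrix_def)
  also have "\<dots> = ?h (xs ! i) (zs ! j)"
    using sum.reindex_bij_betw[OF bij_betw_nth[OF assms refl refl]] by fast
  finally show "(index_matrix xs ys f * index_matrix ys zs g) $$ (i, j) =
      index_matrix xs zs ?h $$ (i, j)"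
    using ij by (simp add: index_matrix_def)
qed (auto simp: index_matrix_def)

lemma index_matrix_identity:
  assumes "distinct xs"
  shows "index_matrix xs xs (\<lambda>x y. if x = y then 1 else 0) = 1\<^sub>m (length xs)"
  using assms by (auto simp: index_matrix_def nth_eq_iff_index_eq intro!: eq_matI)

text \<open>The functions \<open>Q\<close> and \<open>S\<close> describe mutually inverse base changes between two index sets.
  Everything is expressed by sums over these sets, so the chosen orderings drop out; in particular the
  determinant does not depend on the ordering.\<close>

lemma det_matrix_of_intertwining:
  assumes xs: "distinct xs" and ys: "distinct ys"
    and QS: "\<And>x x'. x \<in> set xs \<Longrightarrow> x' \<in> set xs \<Longrightarrow>
      (\<Sum>y \<in> set ys. Q x y * S y x') = (if x = x' then 1 else 0)"
    and SQ: "\<And>y y'. y \<in> set ys \<Longrightarrow> y' \<in> set ys \<Longrightarrow>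
      (\<Sum>x \<in> set xs. S y x * Q x y') = (if y = y' then 1 else 0)"
    and AQ: "\<And>x y. x \<in> set xs \<Longrightarrow> y \<in> set ys \<Longrightarrow>
      (\<Sum>x' \<in> set xs. A x x' * Q x' y) = (\<Sum>y' \<in> set ys. Q x y' * B y' y)"
  shows "det (matrix_of xs A) = det (matrix_of ys B)"
  unfolding matrix_of_eq_index_matrix
proof (rule det_eq_of_intertwining[OF index_matrix_carrier index_matrix_carrier
      index_matrix_carrier index_matrix_carrier])
  show "index_matrix xs ys Q * index_matrix ys xs S = 1\<^sub>m (length xs)"
    unfolding index_matrix_mult[OF ys] index_matrix_identity[OF xs, symmetric]
    by (rule index_matrix_cong) (rule QS)
  show "index_matrix ys xs S * index_matrix xs ys Q = 1\<^sub>m (length ys)"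
    unfolding index_matrix_mult[OF xs] index_matrix_identity[OF ys, symmetric]
    by (rule index_matrix_cong) (rule SQ)
  show "index_matrix xs xs A * index_matrix xs ys Q = index_matrix xs ys Q * index_matrix ys ys B"
    unfolding index_matrix_mult[OF xs] index_matrix_mult[OF ys]
    by (rule index_matrix_cong) (rule AQ)
qed

lemma det_matrix_of_append:
  assumes "\<And>x y. x \<in> set xs \<Longrightarrow> y \<in> set ys \<Longrightarrow> f y x = 0"
  shows "det (matrix_of (xs @ ys) f) = det (matrix_of xs f) * det (matrix_of ys f)"
proof -
  have "matrix_of (xs @ ys) f = four_block_mat (matrix_of xs f) (index_matrix xs ys f)
      (index_matrix ys xs f) (matrix_of ys f)"
    by (rule eq_matI) (auto simp: matrix_of_def index_matrix_def nth_append)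
  moreover have "index_matrix ys xs f = 0\<^sub>m (length ys) (length xs)"
    using assms by (auto simp: index_matrix_def intro!: eq_matI)
  ultimately show ?thesis
    by (simp add: det_four_block_mat_lower_left_zero[OF _ index_matrix_carrier]
      matrix_of_eq_index_matrix index_matrix_carrier)
qed

lemma det_matrix_of_concat:
  assumes "distinct js"
    and "\<And>i j x y. i \<in> set js \<Longrightarrow> j \<in> set js \<Longrightarrow> i \<noteq> j \<Longrightarrow> x \<in> set (block i) \<Longrightarrow> y \<in> set (block j) \<Longrightarrow>
      f x y = 0"
  shows "det (matrix_of (concat (map block js)) f) = (\<Prod>j \<in> set js. det (matrix_of (block j) f))"
  using assms
proof (induction js)
  case Nil
  then show ?case by (simp add: matrix_of_def det_dim_zero)
next
  case (Cons j js)
  have "det (matrix_of (block j @ concat (map block js)) f) =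
      det (matrix_of (block j) f) * det (matrix_of (concat (map block js)) f)"
    using Cons.prems by (intro det_matrix_of_append) fastforce
  moreover have "det (matrix_of (concat (map block js)) f) =
      (\<Prod>j \<in> set js. det (matrix_of (block j) f))"
    using Cons.prems(1) by (intro Cons.IH Cons.prems(2)) auto
  ultimately show ?case using Cons.prems(1) by simp
qed

lemma distinct_concat_blocks:
  assumes "distinct js" "\<And>j. j \<in> set js \<Longrightarrow> distinct (block j)"
    and "\<And>i j. i \<in> set js \<Longrightarrow> j \<in> set js \<Longrightarrow> i \<noteq> j \<Longrightarrow> set (block i) \<inter> set (block j) = {}"
  shows "distinct (concat (map block js))"
  using assms
proof (induction js)
  case (Cons j js)
  have "distinct (concat (map block js))"
    using Cons.prems by (intro Cons.IH) auto
  moreover have "set (block j) \<inter> set (concat (map block js)) = {}"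
    using Cons.prems(1) Cons.prems(3)[of j] by fastforce
  ultimately show ?case using Cons.prems(2)[of j] by simp
qed simp

section \<open>The determinant of the covering\<close>

lemma finsum_module_mat:
  fixes F :: "'h \<Rightarrow> 'a::comm_ring_1 mat"
  assumes "finite A" and "\<And>h. h \<in> A \<Longrightarrow> F h \<in> carrier_mat m n"
  shows "finsum (module_mat TYPE('a) m n) F A = mat m n (\<lambda>(i, j). \<Sum>h \<in> A. F h $$ (i, j))"
proof -
  interpret abelian_group "module_mat TYPE('a) m n" by (rule abelian_group_mat)
  show ?thesis
    using assms
  proof (induction A)
    case empty
    show ?case by (auto simp: module_mat_simps intro!: eq_matI)
  next
    case (insert h A)
    then have "finsum (module_mat TYPE('a) m n) F (insert h A) =
        F h + mat m n (\<lambda>(i, j). \<Sum>h \<in> A. F h $$ (i, j))"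
      by (subst finsum_insert) (auto simp: module_mat_simps)
    also have "\<dots> = mat m n (\<lambda>(i, j). \<Sum>h \<in> insert h A. F h $$ (i, j))"
      using insert by (auto intro!: eq_matI)
    finally show ?case .
  qed
qed

theorem theorem8:
  fixes D :: "'v pair_pre_digraph"
    and \<Gamma> :: "('g, 'b) monoid_scheme"
    and \<alpha> :: "'v \<times> 'v \<Rightarrow> 'g"
    and w :: "'v \<Rightarrow> 'v \<Rightarrow> complex"
    and \<rho> :: "nat \<Rightarrow> 'g \<Rightarrow> complex mat"
    and d :: "nat \<Rightarrow> nat"
    and n m p k :: nat
    and vs :: "'v list"
    and cs :: "('v \<times> 'g) list"
  assumes "pair_fin_digraph D"
    and "Digraph_Component.connected (with_proj D)"
    and "card (pverts D) = n"
    and "card (parcs D) = m"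
    and "group \<Gamma>"
    and "finite (carrier \<Gamma>)"
    and "Coset.order \<Gamma> = p"
    and "pseudo_ordinary_voltage D \<Gamma> \<alpha>"
    and "weighted_matrix D w"
    and "complete_irreducibles \<Gamma> k d \<rho>"
    and "d 1 = 1"
    and "\<forall>g \<in> carrier \<Gamma>. \<rho> 1 g = 1\<^sub>m 1"
    and "Digraph_Component.connected (with_proj (derived_digraph D \<Gamma> \<alpha>))"
    and "ordering_of vs (pverts D)"
    and "ordering_of cs (pverts (derived_digraph D \<Gamma> \<alpha>))"
  shows "det (matrix_of cs (derived_weight D \<Gamma> \<alpha> w)) =
    (\<Prod>j = 1..k. det (\<Oplus>\<^bsub>module_mat TYPE(complex) (d j * n) (d j * n)\<^esub> h \<in> carrier \<Gamma>.
        kronecker (\<rho> j h) (matrix_of vs (voltage_weight D \<alpha> w h))) ^ d j)"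
proof -
  note \<Gamma> = \<open>group \<Gamma>\<close> and fin = \<open>finite (carrier \<Gamma>)\<close>
    and irr = \<open>complete_irreducibles \<Gamma> k d \<rho>\<close>
  interpret group \<Gamma> by (rule \<Gamma>)
  have rep: "representation \<Gamma> (d j) (\<rho> j)" if "j \<in> {1..k}" for j
    using irr that by (auto simp: complete_irreducibles_def irreducible_representation_def)
  note \<rho>c = representation_carrier[OF \<Gamma> rep]
  have vs: "distinct vs" "set vs = pverts D" and cs: "distinct cs" "set cs = pverts D \<times> carrier \<Gamma>"
    using assms(14,15) by (auto simp: ordering_of_def derived_digraph_def)
  have n: "length vs = n" using vs assms(3) distinct_card by force
  have \<alpha>: "\<alpha> (u, v) \<in> carrier \<Gamma>" if "(u, v) \<in> parcs D" for u v
    using assms(8) that by (auto simp: pseudo_ordinary_voltage_def)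
  define q where "q = (of_nat (card (carrier \<Gamma>)) :: complex)"
  have q: "q \<noteq> 0" using fin by (auto simp: q_def)

  \<comment> \<open>The pair \<open>(j, a)\<close> numbers the copies of \<open>\<rho>\<^sub>j\<close>. Inside a block, \<open>b\<close> varies slower than the vertex,
    which is the index order of the Kronecker product.\<close>
  define blocks where "blocks = (SIGMA j:{1..k}. {..<d j})"
  have "finite blocks" by (simp add: blocks_def)
  then obtain js where js: "distinct js" "set js = blocks"
    using finite_distinct_list by blast
  define block :: "nat \<times> nat \<Rightarrow> ((nat \<times> nat \<times> nat) \<times> 'v) list"
    where "block = (\<lambda>(j, a). map (\<lambda>(b, u). ((j, a, b), u)) (List.product [0..<d j] vs))"
  define zs where "zs = concat (map block js)"
  have block_set: "set (block (j, a)) = {((j, a, b), u) | b u. b < d j \<and> u \<in> pverts D}" for j a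
    by (auto simp: block_def vs(2) image_iff)
  have zs_set: "set zs = {((j, a, b), u) | j a b u. j \<in> {1..k} \<and> a < d j \<and> b < d j \<and> u \<in> pverts D}"
    by (auto simp: zs_def js(2) blocks_def block_set)
  have zs: "distinct zs"
    unfolding zs_def
  proof (rule distinct_concat_blocks[OF js(1)])
    show "distinct (block j)" for j
      by (cases j) (auto simp: block_def distinct_map distinct_product vs(1) inj_on_def)
    show "set (block i) \<inter> set (block j) = {}" if "i \<noteq> j" for i j
      using that by (cases i; cases j) (auto simp: block_set)
  qed

  \<comment> \<open>Base change by matrix coefficients, tensored with the identity on vertices.\<close>
  define Q :: "'v \<times> 'g \<Rightarrow> (nat \<times> nat \<times> nat) \<times> 'v \<Rightarrow> complex"
    where "Q = (\<lambda>(u, g) ((j, a, b), v). if v = u then \<rho> j g $$ (a, b) else 0)"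
  define S :: "(nat \<times> nat \<times> nat) \<times> 'v \<Rightarrow> 'v \<times> 'g \<Rightarrow> complex"
    where "S = (\<lambda>((j, a, b), v) (u, g).
      if v = u then of_nat (d j) / q * \<rho> j (inv\<^bsub>\<Gamma>\<^esub> g) $$ (b, a) else 0)"
  define B :: "(nat \<times> nat \<times> nat) \<times> 'v \<Rightarrow> (nat \<times> nat \<times> nat) \<times> 'v \<Rightarrow> complex"
    where "B = (\<lambda>((j, a, b), u) ((j', a', b'), v). if j = j' \<and> a = a'
      then \<Sum>h \<in> carrier \<Gamma>. \<rho> j h $$ (b, b') * voltage_weight D \<alpha> w h u v else 0)"

  have "det (matrix_of cs (derived_weight D \<Gamma> \<alpha> w)) = det (matrix_of zs B)"
  proof (rule det_matrix_of_intertwining[OF cs(1) zs])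
    fix x x' assume "x \<in> set cs" "x' \<in> set cs"
    then obtain u g u' g' where x: "x = (u, g)" "x' = (u', g')" and u: "u \<in> pverts D" "u' \<in> pverts D"
      and g: "g \<in> carrier \<Gamma>" "g' \<in> carrier \<Gamma>" by (auto simp: cs(2))
    let ?I = "SIGMA j:{1..k}. SIGMA a:{..<d j}. {..<d j}"
    have "(\<Sum>y \<in> set zs. Q x y * S y x') =
        (\<Sum>y \<in> (\<lambda>t. (t, u)) ` ?I. Q x y * S y x')"
      by (rule sum.mono_neutral_right[OF finite_set]) (auto simp: zs_set Q_def x u)
    also have "\<dots> = (\<Sum>t \<in> ?I. Q x (t, u) * S (t, u) x')"
      by (subst sum.reindex) (auto simp: inj_on_def)
    also have "\<dots> = (\<Sum>j = 1..k. \<Sum>a<d j. \<Sum>b<d j. Q x ((j, a, b), u) * S ((j, a, b), u) x')"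
      by (simp add: sum.Sigma split_def)
    also have "\<dots> = (if u = u' then \<Sum>j = 1..k. \<Sum>a<d j. \<Sum>b<d j. of_nat (d j) / q *
        (\<rho> j g $$ (a, b) * \<rho> j (inv\<^bsub>\<Gamma>\<^esub> g') $$ (b, a)) else 0)"
      by (simp add: Q_def S_def x mult_ac)
    also have "\<dots> = (if x = x' then 1 else 0)"
      unfolding q_def irreducible_coefficients_complete[OF \<Gamma> fin irr g] by (auto simp: x)
    finally show "(\<Sum>y \<in> set zs. Q x y * S y x') = (if x = x' then 1 else 0)" .
  next
    fix y y' assume "y \<in> set zs" "y' \<in> set zs"
    then obtain j a b u j' a' b' u' where y: "y = ((j, a, b), u)" "y' = ((j', a', b'), u')"
      and j: "j \<in> {1..k}" "j' \<in> {1..k}" and bounds: "a < d j" "b < d j" "a' < d j'" "b' < d j'"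
      and u: "u \<in> pverts D" "u' \<in> pverts D"
      by (auto simp: zs_set)
    have "(\<Sum>x \<in> set cs. S y x * Q x y') = (\<Sum>x \<in> Pair u ` carrier \<Gamma>. S y x * Q x y')"
      by (rule sum.mono_neutral_right[OF finite_set]) (auto simp: cs(2) S_def y u)
    also have "\<dots> = (\<Sum>g \<in> carrier \<Gamma>. S y (u, g) * Q (u, g) y')"
      by (subst sum.reindex) (auto simp: inj_on_def)
    also have "\<dots> = (if u = u' then of_nat (d j) / q *
        (\<Sum>g \<in> carrier \<Gamma>. \<rho> j (inv\<^bsub>\<Gamma>\<^esub> g) $$ (b, a) * \<rho> j' g $$ (a', b')) else 0)"
      by (simp add: Q_def S_def y sum_distrib_left mult_ac)
    also have "\<dots> = (if y = y' then 1 else 0)"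
      unfolding irreducible_coefficients_orthogonal[OF \<Gamma> irr j bounds] q_def[symmetric]
      using q bounds by (auto simp: y)
    finally show "(\<Sum>x \<in> set cs. S y x * Q x y') = (if y = y' then 1 else 0)" .
  next
    fix x y assume "x \<in> set cs" "y \<in> set zs"
    then obtain u g j a b v where x: "x = (u, g)" and u: "u \<in> pverts D" and g: "g \<in> carrier \<Gamma>"
      and y: "y = ((j, a, b), v)" and j: "j \<in> {1..k}" and ab: "a < d j" "b < d j" and v: "v \<in> pverts D"
      by (auto simp: zs_set cs(2))
    \<comment> \<open>Both sides equal \<open>\<Sum>\<^sub>h W\<^sub>h(u, v) \<rho>\<^sub>j(g h)\<^sub>a\<^sub>b\<close>: on the left the only arc from \<open>(u, g)\<close> to the fibre over \<open>v\<close>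
      has \<open>h = \<alpha>(u, v)\<close>, on the right \<open>\<rho>\<^sub>j(g h)\<close> is expanded as a matrix product.\<close>
    let ?r = "if (u, v) \<in> parcs D then w u v * \<rho> j (g \<otimes>\<^bsub>\<Gamma>\<^esub> \<alpha> (u, v)) $$ (a, b) else 0"
    have "(\<Sum>x' \<in> set cs. derived_weight D \<Gamma> \<alpha> w x x' * Q x' y) =
        (\<Sum>x' \<in> (if (u, v) \<in> parcs D then {(v, g \<otimes>\<^bsub>\<Gamma>\<^esub> \<alpha> (u, v))} else {}).
          derived_weight D \<Gamma> \<alpha> w x x' * Q x' y)"
      by (rule sum.mono_neutral_right[OF finite_set])
        (use v g \<alpha> in \<open>auto simp: cs(2) Q_def derived_weight_def x y split: if_splits\<close>)
    also have "\<dots> = ?r" by (simp add: Q_def derived_weight_def x y)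
    also have "?r = (\<Sum>h \<in> carrier \<Gamma>. voltage_weight D \<alpha> w h u v * \<rho> j (g \<otimes>\<^bsub>\<Gamma>\<^esub> h) $$ (a, b))"
    proof (cases "(u, v) \<in> parcs D")
      case True
      have "(\<Sum>h \<in> carrier \<Gamma>. voltage_weight D \<alpha> w h u v * \<rho> j (g \<otimes>\<^bsub>\<Gamma>\<^esub> h) $$ (a, b)) =
          (\<Sum>h \<in> {\<alpha> (u, v)}. voltage_weight D \<alpha> w h u v * \<rho> j (g \<otimes>\<^bsub>\<Gamma>\<^esub> h) $$ (a, b))"
        by (rule sum.mono_neutral_right) (use fin \<alpha>[OF True] in \<open>auto simp: voltage_weight_def\<close>)
      then show ?thesis using True by (simp add: voltage_weight_def)
    qed (simp add: voltage_weight_def)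
    also have "\<dots> = (\<Sum>h \<in> carrier \<Gamma>. \<Sum>c<d j.
        \<rho> j g $$ (a, c) * (\<rho> j h $$ (c, b) * voltage_weight D \<alpha> w h u v))"
      using g ab by (intro sum.cong) (simp_all add: representation_mult[OF \<Gamma> rep[OF j]]
        index_mult_mat_sum[OF \<rho>c[OF j] \<rho>c[OF j]] sum_distrib_left mult_ac del: index_mult_mat)
    also have "\<dots> = (\<Sum>c<d j. \<Sum>h \<in> carrier \<Gamma>.
        \<rho> j g $$ (a, c) * (\<rho> j h $$ (c, b) * voltage_weight D \<alpha> w h u v))"
      by (rule sum.swap)
    also have "\<dots> = (\<Sum>c<d j. Q x ((j, a, c), u) * B ((j, a, c), u) y)"
      by (simp add: Q_def B_def x y sum_distrib_left)
    also have "\<dots> = (\<Sum>y' \<in> (\<lambda>c. ((j, a, c), u)) ` {..<d j}. Q x y' * B y' y)"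
      by (subst sum.reindex) (auto simp: inj_on_def)
    also have "\<dots> = (\<Sum>y' \<in> set zs. Q x y' * B y' y)"
      by (rule sum.mono_neutral_left[OF finite_set]) (use j ab u in \<open>auto simp: zs_set Q_def B_def x y split: if_splits\<close>)
    finally show "(\<Sum>x' \<in> set cs. derived_weight D \<Gamma> \<alpha> w x x' * Q x' y) =
        (\<Sum>y' \<in> set zs. Q x y' * B y' y)" .
  qed
  also have "\<dots> = (\<Prod>ja \<in> blocks. det (matrix_of (block ja) B))"
    unfolding zs_def js(2)[symmetric]
    by (rule det_matrix_of_concat[OF js(1)]) (auto simp: block_set B_def split: if_splits)
  also have "\<dots> = (\<Prod>j = 1..k. \<Prod>a<d j. det (matrix_of (block (j, a)) B))"
    by (simp add: blocks_def prod.Sigma split_def)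
  also have "\<dots> = (\<Prod>j = 1..k. det (\<Oplus>\<^bsub>module_mat TYPE(complex) (d j * n) (d j * n)\<^esub> h \<in> carrier \<Gamma>.
        kronecker (\<rho> j h) (matrix_of vs (voltage_weight D \<alpha> w h))) ^ d j)"
  proof (rule prod.cong[OF refl])
    fix j assume j: "j \<in> {1..k}"
    let ?K = "\<lambda>h. kronecker (\<rho> j h) (matrix_of vs (voltage_weight D \<alpha> w h))"
    have K: "?K h \<in> carrier_mat (d j * n) (d j * n)" if "h \<in> carrier \<Gamma>" for h
      using \<rho>c[OF j that] by (simp add: kronecker_def matrix_of_def n)
    let ?M = "mat (d j * n) (d j * n) (\<lambda>(i, l). \<Sum>h \<in> carrier \<Gamma>. ?K h $$ (i, l))"
    have M: "finsum (module_mat TYPE(complex) (d j * n) (d j * n)) ?K (carrier \<Gamma>) = ?M"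
      by (rule finsum_module_mat[OF fin K])
    have "matrix_of (block (j, a)) B = ?M" for a
    proof (rule eq_matI)
      have len: "length (block (j, a)) = d j * n" by (simp add: block_def n)
      have nth: "block (j, a) ! i = ((j, a, i div n), vs ! (i mod n))" if i: "i < d j * n" for i
        using i less_mult_imp_div_less[OF i] by (simp add: block_def product_nth n)
      fix i l assume "i < dim_row ?M" "l < dim_col ?M"
      then have il: "i < d j * n" "l < d j * n" by auto
      then have "n > 0" by (cases n) auto
      then have K_entry: "?K h $$ (i, l) =
          \<rho> j h $$ (i div n, l div n) * voltage_weight D \<alpha> w h (vs ! (i mod n)) (vs ! (l mod n))"
        if "h \<in> carrier \<Gamma>" for h
        using il carrier_matD[OF \<rho>c[OF j that]] by (simp add: matrix_of_def kronecker_def n)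
      show "matrix_of (block (j, a)) B $$ (i, l) = ?M $$ (i, l)"
        using il K_entry by (simp add: matrix_of_def[of "block _"] len nth B_def)
    qed (auto simp: matrix_of_def block_def n)
    then show "(\<Prod>a<d j. det (matrix_of (block (j, a)) B)) =
        det (finsum (module_mat TYPE(complex) (d j * n) (d j * n)) ?K (carrier \<Gamma>)) ^ d j"
      by (simp add: M)
  qed
  finally show ?thesis .
qed

end
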